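(* Let $\mathcal{H}$ be a complex separable Hilbert space, let $\mathcal{A}\subseteq\mathscr{B}(\mathcal{H})$ be a von Neumann algebra and let $\tau=\{\tau_t:t\in\mathbb{R}_+\}$ be a quantum Markov semigroup on $\mathcal{A}$. Let $(\mathcal{K},\mathcal{B},\theta)$ be its minimal dilation and let $p$ be the projection of $\mathcal{K}$ onto $\mathcal{H}$. Then the compression map $z\mapsto pzp$, restricted to $\mathcal{P}(\theta)$, is a completely positive map which maps the operator space $\mathcal{P}(\theta)$ completely isometrically and bijectively onto $\mathcal{P}(\tau)$.
   Context: Semigroups. A quantum dynamical semigroup is a triple $(\mathcal{H},\mathcal{A},\tau)$ with $\mathcal{H}$ a complex separable Hilbert space, $\mathcal{A}\subseteq\mathscr{B}(\mathcal{H})$ a von Neumann algebra, and $\tau=\{\tau_t:t\in\mathbb{R}_+\}$ a family of normal completely positive linear maps on $\mathcal{A}$ with $\tau_0=\mathrm{id}$, $\tau_s\circ\tau_t=\tau_{s+t}$, $\tau_t(1)\le 1$ for all $s,t$, and $t\mapsto\tau_t(x)$ strongly continuous for each $x\in\mathcal{A}$. It is a quantum Markov semigroup if $\tau_t(1)=1$ for all $t$, and an $E$-semigroup if every $\tau_t$ is a $*$-endomorphism. Minimal dilation. For a Hilbert space $\mathcal{K}\supseteq\mathcal{H}$ with projection $p$ onto $\mathcal{H}$, operators $x\in\mathscr{B}(\mathcal{H})$ are identified with $pxp\in\mathscr{B}(\mathcal{K})$. The minimal dilation of $(\mathcal{H},\mathcal{A},\tau)$, known to exist and to be unique up to unitary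 equivalence, is an $E$-semigroup $(\mathcal{K},\mathcal{B},\theta)$ with: $\mathcal{K}\supseteq\mathcal{H}$; $\mathcal{B}\subseteq\mathscr{B}(\mathcal{K})$ a von Neumann algebra with $p\mathcal{B}p=\mathcal{A}$; $\tau_t(x)=p\theta_t(x)p$ for all $x\in\mathcal{A}$, $t\ge 0$; $\mathcal{K}=\overline{\mathrm{span}}\{\theta_{r_1}(x_1)\cdots\theta_{r_n}(x_n)u: r_1>r_2>\cdots>r_n\ge 0,\ x_i\in\mathcal{A},\ u\in\mathcal{H}\}$; and $\mathcal{B}$ is generated as a von Neumann algebra by $\{\theta_t(x):t\in\mathbb{R}_+,x\in\mathcal{A}\}$. When $\tau$ is a quantum Markov semigroup, $\theta$ is unital and $\theta_t(p)$ increases to $1_{\mathcal{K}}$ as $t\to\infty$. Peripheral spaces. For a quantum dynamical semigroup $\sigma$ on a von Neumann algebra $\mathcal{M}$ and $a\in\mathbb{R}$, $E_a(\sigma)=\{x\in\mathcal{M}:\sigma_t(x)=\exp(iat)x\ \ \forall t\in\mathbb{R}_+\}$; $E(\sigma)$ is the linear span of $\bigcup_{a\in\mathbb{R}}E_a(\sigma)$; $\mathcal{P}(\sigma)$ is the norm closure of $E(\sigma)$. *)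

theory Defs
  imports "HOL-Analysis.Analysis"
begin

section \<open>Complex Hilbert spaces\<close>

class complex_vector = real_vector +
  fixes scaleC :: "complex \<Rightarrow> 'a \<Rightarrow> 'a"  (infixr \<open>*\<^sub>C\<close> 75)
  assumes scaleC_add_right: "c *\<^sub>C (x + y) = c *\<^sub>C x + c *\<^sub>C y"
    and scaleC_add_left: "(c + d) *\<^sub>C x = c *\<^sub>C x + d *\<^sub>C x"
    and scaleC_scaleC: "c *\<^sub>C d *\<^sub>C x = (c * d) *\<^sub>C x"
    and scaleC_of_real: "complex_of_real r *\<^sub>C x = r *\<^sub>R x"

global_interpretation complex_vector: vector_space "scaleC :: complex \<Rightarrow> 'a \<Rightarrow> 'a::complex_vector"
  defines cspan = complex_vector.span
proof unfold_locales
  fix x :: 'a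
  show "1 *\<^sub>C x = x"
    using scaleC_of_real[of 1 x] by simp
qed (rule scaleC_add_right scaleC_add_left scaleC_scaleC)+

text \<open>The inner product is conjugate-linear in the first and linear in the second argument.
  Completeness and the norm come from \<^class>\<open>banach\<close>; since the norm is definite, so is the
  inner product.\<close>

class complex_hilbert_space = complex_vector + banach +
  fixes cinner :: "'a \<Rightarrow> 'a \<Rightarrow> complex"
  assumes cinner_commute: "cinner x y = cnj (cinner y x)"
    and cinner_add_right: "cinner x (y + z) = cinner x y + cinner x z"
    and cinner_scaleC_right: "cinner x (c *\<^sub>C y) = c * cinner x y"
    and cinner_self: "cinner x x = complex_of_real ((norm x)\<^sup>2)"

lemma norm_scaleC: "norm (c *\<^sub>C x) = cmod c * norm (x :: 'a::complex_hilbert_space)"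
proof -
  have "cinner (c *\<^sub>C x) (c *\<^sub>C x) = c * cnj (c * cinner x x)"
    using cinner_commute[of "c *\<^sub>C x" x] by (simp add: cinner_scaleC_right)
  also have "\<dots> = complex_of_real ((cmod c * norm x)\<^sup>2)"
    using complex_norm_square[of c] by (simp add: cinner_self power_mult_distrib)
  finally have "complex_of_real ((norm (c *\<^sub>C x))\<^sup>2) = complex_of_real ((cmod c * norm x)\<^sup>2)"
    by (simp only: cinner_self)
  then have "(norm (c *\<^sub>C x))\<^sup>2 = (cmod c * norm x)\<^sup>2"
    by (simp only: of_real_eq_iff)
  then show ?thesis
    by (simp add: power2_eq_iff_nonneg)
qed

instantiation complex :: complex_hilbert_space
begin
definition scaleC_complex :: "complex \<Rightarrow> complex \<Rightarrow> complex" where "scaleC_complex = (*)"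
definition cinner_complex :: "complex \<Rightarrow> complex \<Rightarrow> complex" where "cinner_complex x y = cnj x * y"
instance
  by standard
    (auto simp: scaleC_complex_def cinner_complex_def algebra_simps scaleR_conv_of_real
      complex_norm_square[symmetric] complex_mult_cnj cmod_power2)
end


section \<open>Bounded operators\<close>

text \<open>The library type \<^typ>\<open>'a \<Rightarrow>\<^sub>L 'b\<close> consists of the bounded real-linear maps with the operator
  norm; the bounded complex-linear ones form the closed subspace \<open>clinear_ops\<close>.\<close>

definition clinear_ops :: "('a::complex_hilbert_space \<Rightarrow>\<^sub>L 'b::complex_hilbert_space) set" where
  "clinear_ops = {x. \<forall>c v. blinfun_apply x (c *\<^sub>C v) = c *\<^sub>C blinfun_apply x v}"

lemma bounded_linear_scaleC: "bounded_linear (\<lambda>v. c *\<^sub>C (v :: 'a::complex_hilbert_space))"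
proof
  show "c *\<^sub>C (r *\<^sub>R v) = r *\<^sub>R c *\<^sub>C v" for r and v :: 'a
    by (metis scaleC_of_real scaleC_scaleC mult.commute)
  show "\<exists>K. \<forall>v :: 'a. norm (c *\<^sub>C v) \<le> norm v * K"
    by (metis norm_scaleC mult.commute order_refl)
qed (rule scaleC_add_right)

instantiation blinfun :: (real_normed_vector, complex_hilbert_space) complex_vector
begin
lift_definition scaleC_blinfun :: "complex \<Rightarrow> ('a \<Rightarrow>\<^sub>L 'b) \<Rightarrow> ('a \<Rightarrow>\<^sub>L 'b)" is "\<lambda>c x v. c *\<^sub>C x v"
  by (rule bounded_linear_compose[OF bounded_linear_scaleC])
instance
  by standard
    (transfer, simp add: scaleC_add_right scaleC_add_left scaleC_scaleC scaleC_of_real)+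
end

text \<open>For a complex-linear \<open>x\<close> the adjoint exists and is unique by the Riesz representation
  theorem; likewise the orthogonal projection onto a closed subspace exists and is unique.\<close>

definition adj ::
  "('a::complex_hilbert_space \<Rightarrow>\<^sub>L 'b::complex_hilbert_space) \<Rightarrow> ('b \<Rightarrow>\<^sub>L 'a)" where
  "adj x = (THE y. \<forall>u v. cinner (blinfun_apply x u) v = cinner u (blinfun_apply y v))"

definition orth_proj :: "'a::complex_hilbert_space set \<Rightarrow> ('a \<Rightarrow>\<^sub>L 'a)" where
  "orth_proj S = (THE p. \<forall>v. blinfun_apply p v \<in> S \<and>
      (\<forall>w\<in>S. cinner w (v - blinfun_apply p v) = 0))"

definition positive_op :: "('a::complex_hilbert_space \<Rightarrow>\<^sub>L 'a) \<Rightarrow> bool" where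
  "positive_op x \<longleftrightarrow> x \<in> clinear_ops \<and> (\<forall>v. cinner v (blinfun_apply x v) \<in> \<real>\<^sub>\<ge>\<^sub>0)"

definition von_neumann_algebra :: "('a::complex_hilbert_space \<Rightarrow>\<^sub>L 'a) set \<Rightarrow> bool" where
  "von_neumann_algebra A \<longleftrightarrow>
     A \<subseteq> clinear_ops \<and> id_blinfun \<in> A \<and>
     (\<forall>x\<in>A. \<forall>y\<in>A. x + y \<in> A \<and> x o\<^sub>L y \<in> A) \<and>
     (\<forall>c. \<forall>x\<in>A. c *\<^sub>C x \<in> A) \<and> (\<forall>x\<in>A. adj x \<in> A) \<and>
     closedin strong_operator_topology A"

text \<open>The ultraweak (\<open>\<sigma>\<close>-weak) topology is the initial topology for the functionals
  \<open>x \<mapsto> \<Sum>k. \<langle>\<xi> k, x (\<eta> k)\<rangle>\<close> with square-summable \<open>\<xi>\<close>, \<open>\<eta>\<close>.\<close>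

definition ultraweak_functionals :: "(('a::complex_hilbert_space \<Rightarrow>\<^sub>L 'a) \<Rightarrow> complex) set" where
  "ultraweak_functionals =
     {\<lambda>x. \<Sum>k. cinner (\<xi> k) (blinfun_apply x (\<eta> k)) | (\<xi> :: nat \<Rightarrow> 'a) \<eta>.
        summable (\<lambda>k. (norm (\<xi> k))\<^sup>2) \<and> summable (\<lambda>k. (norm (\<eta> k))\<^sup>2)}"

definition ultraweak_topology :: "('a::complex_hilbert_space \<Rightarrow>\<^sub>L 'a) topology" where
  "ultraweak_topology =
     topology_generated_by {f -` U | f U. f \<in> ultraweak_functionals \<and> open U}"


section \<open>Matrices of operators and completely positive maps\<close>

text \<open>An \<open>n \<times> n\<close> operator matrix \<open>X\<close> is given by its entries \<open>X i j\<close> for \<open>i, j < n\<close>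
  and acts on the \<open>n\<close>-fold Hilbert space direct sum, whose vectors are written \<open>\<xi> i\<close> for
  \<open>i < n\<close> (values beyond \<open>n\<close> are irrelevant).\<close>

definition mat_apply ::
  "nat \<Rightarrow> (nat \<Rightarrow> nat \<Rightarrow> ('a::complex_hilbert_space \<Rightarrow>\<^sub>L 'a)) \<Rightarrow> (nat \<Rightarrow> 'a) \<Rightarrow> nat \<Rightarrow> 'a" where
  "mat_apply n X \<xi> i = (\<Sum>j<n. blinfun_apply (X i j) (\<xi> j))"

definition mat_positive ::
  "nat \<Rightarrow> (nat \<Rightarrow> nat \<Rightarrow> ('a::complex_hilbert_space \<Rightarrow>\<^sub>L 'a)) \<Rightarrow> bool" where
  "mat_positive n X \<longleftrightarrow> (\<forall>\<xi>. (\<Sum>i<n. cinner (\<xi> i) (mat_apply n X \<xi> i)) \<in> \<real>\<^sub>\<ge>\<^sub>0)"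

definition mat_norm ::
  "nat \<Rightarrow> (nat \<Rightarrow> nat \<Rightarrow> ('a::complex_hilbert_space \<Rightarrow>\<^sub>L 'a)) \<Rightarrow> real" where
  "mat_norm n X = (SUP \<xi> \<in> {\<xi>. L2_set (\<lambda>i. norm (\<xi> i)) {..<n} \<le> 1}.
      L2_set (\<lambda>i. norm (mat_apply n X \<xi> i)) {..<n})"

definition clinear_on :: "'a::complex_vector set \<Rightarrow> ('a \<Rightarrow> 'b::complex_vector) \<Rightarrow> bool" where
  "clinear_on S \<Phi> \<longleftrightarrow>
     (\<forall>x\<in>S. \<forall>y\<in>S. \<Phi> (x + y) = \<Phi> x + \<Phi> y) \<and> (\<forall>c. \<forall>x\<in>S. \<Phi> (c *\<^sub>C x) = c *\<^sub>C \<Phi> x)"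

definition completely_positive_on ::
  "('a::complex_hilbert_space \<Rightarrow>\<^sub>L 'a) set \<Rightarrow>
     (('a \<Rightarrow>\<^sub>L 'a) \<Rightarrow> ('b::complex_hilbert_space \<Rightarrow>\<^sub>L 'b)) \<Rightarrow> bool" where
  "completely_positive_on S \<Phi> \<longleftrightarrow> clinear_on S \<Phi> \<and>
     (\<forall>n X. (\<forall>i<n. \<forall>j<n. X i j \<in> S) \<longrightarrow> mat_positive n X \<longrightarrow>
        mat_positive n (\<lambda>i j. \<Phi> (X i j)))"

definition completely_isometric_on ::
  "('a::complex_hilbert_space \<Rightarrow>\<^sub>L 'a) set \<Rightarrow>
     (('a \<Rightarrow>\<^sub>L 'a) \<Rightarrow> ('b::complex_hilbert_space \<Rightarrow>\<^sub>L 'b)) \<Rightarrow> bool" where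
  "completely_isometric_on S \<Phi> \<longleftrightarrow> clinear_on S \<Phi> \<and>
     (\<forall>n X. (\<forall>i<n. \<forall>j<n. X i j \<in> S) \<longrightarrow>
        mat_norm n (\<lambda>i j. \<Phi> (X i j)) = mat_norm n X)"

definition normal_on ::
  "('a::complex_hilbert_space \<Rightarrow>\<^sub>L 'a) set \<Rightarrow> (('a \<Rightarrow>\<^sub>L 'a) \<Rightarrow> ('a \<Rightarrow>\<^sub>L 'a)) \<Rightarrow> bool" where
  "normal_on A \<Phi> \<longleftrightarrow> continuous_map (subtopology ultraweak_topology A) ultraweak_topology \<Phi>"


section \<open>Quantum dynamical semigroups\<close>

text \<open>Only the values \<open>\<tau> t x\<close> with \<open>t \<ge> 0\<close> and \<open>x \<in> A\<close> are meaningful.\<close>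

definition quantum_dynamical_semigroup ::
  "('a::complex_hilbert_space \<Rightarrow>\<^sub>L 'a) set \<Rightarrow> (real \<Rightarrow> ('a \<Rightarrow>\<^sub>L 'a) \<Rightarrow> ('a \<Rightarrow>\<^sub>L 'a)) \<Rightarrow> bool" where
  "quantum_dynamical_semigroup A \<tau> \<longleftrightarrow>
     separable_space (euclidean :: 'a topology) \<and>
     von_neumann_algebra A \<and>
     (\<forall>t\<ge>0. \<tau> t ` A \<subseteq> A \<and> completely_positive_on A (\<tau> t) \<and> normal_on A (\<tau> t)) \<and>
     (\<forall>x\<in>A. \<tau> 0 x = x) \<and>
     (\<forall>s\<ge>0. \<forall>t\<ge>0. \<forall>x\<in>A. \<tau> s (\<tau> t x) = \<tau> (s + t) x) \<and>
     (\<forall>t\<ge>0. positive_op (id_blinfun - \<tau> t id_blinfun)) \<and>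
     (\<forall>x\<in>A. continuous_map (top_of_set {0..}) strong_operator_topology (\<lambda>t. \<tau> t x))"

definition quantum_markov_semigroup ::
  "('a::complex_hilbert_space \<Rightarrow>\<^sub>L 'a) set \<Rightarrow> (real \<Rightarrow> ('a \<Rightarrow>\<^sub>L 'a) \<Rightarrow> ('a \<Rightarrow>\<^sub>L 'a)) \<Rightarrow> bool" where
  "quantum_markov_semigroup A \<tau> \<longleftrightarrow>
     quantum_dynamical_semigroup A \<tau> \<and> (\<forall>t\<ge>0. \<tau> t id_blinfun = id_blinfun)"

definition E_semigroup ::
  "('a::complex_hilbert_space \<Rightarrow>\<^sub>L 'a) set \<Rightarrow> (real \<Rightarrow> ('a \<Rightarrow>\<^sub>L 'a) \<Rightarrow> ('a \<Rightarrow>\<^sub>L 'a)) \<Rightarrow> bool" where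
  "E_semigroup A \<theta> \<longleftrightarrow>
     quantum_dynamical_semigroup A \<theta> \<and>
     (\<forall>t\<ge>0. \<forall>x\<in>A. \<theta> t (adj x) = adj (\<theta> t x) \<and>
        (\<forall>y\<in>A. \<theta> t (x o\<^sub>L y) = \<theta> t x o\<^sub>L \<theta> t y))"

definition peripheral_eigenspace ::
  "('a::complex_hilbert_space \<Rightarrow>\<^sub>L 'a) set \<Rightarrow> (real \<Rightarrow> ('a \<Rightarrow>\<^sub>L 'a) \<Rightarrow> ('a \<Rightarrow>\<^sub>L 'a)) \<Rightarrow>
     real \<Rightarrow> ('a \<Rightarrow>\<^sub>L 'a) set" where
  "peripheral_eigenspace M \<sigma> a =
     {x \<in> M. \<forall>t\<ge>0. \<sigma> t x = exp (\<i> * complex_of_real a * complex_of_real t) *\<^sub>C x}"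

definition peripheral_space ::
  "('a::complex_hilbert_space \<Rightarrow>\<^sub>L 'a) set \<Rightarrow> (real \<Rightarrow> ('a \<Rightarrow>\<^sub>L 'a) \<Rightarrow> ('a \<Rightarrow>\<^sub>L 'a)) \<Rightarrow>
     ('a \<Rightarrow>\<^sub>L 'a) set" where
  "peripheral_space M \<sigma> = closure (cspan (\<Union>a. peripheral_eigenspace M \<sigma> a))"


section \<open>Minimal dilations\<close>

text \<open>The inclusion \<open>\<H> \<subseteq> \<K>\<close> is rendered by a complex-linear isometry \<open>J\<close> from the type \<open>'h\<close> to
  the type \<open>'k\<close>, and \<open>p\<close> is the orthogonal projection onto the range of \<open>J\<close>. An operator \<open>x\<close> on
  \<open>\<H>\<close> is identified with the operator \<open>extend J x\<close> on \<open>\<K>\<close>, which is \<open>x\<close> on \<open>\<H>\<close> and \<open>0\<close> on the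
  orthogonal complement of \<open>\<H>\<close>.\<close>

definition isometric_embedding ::
  "('h::complex_hilbert_space \<Rightarrow>\<^sub>L 'k::complex_hilbert_space) \<Rightarrow> bool" where
  "isometric_embedding J \<longleftrightarrow> J \<in> clinear_ops \<and> (\<forall>u. norm (blinfun_apply J u) = norm u)"

definition extend ::
  "('h::complex_hilbert_space \<Rightarrow>\<^sub>L 'k::complex_hilbert_space) \<Rightarrow> ('h \<Rightarrow>\<^sub>L 'h) \<Rightarrow> ('k \<Rightarrow>\<^sub>L 'k)" where
  "extend J x = J o\<^sub>L x o\<^sub>L adj J"

definition compression ::
  "('k::complex_hilbert_space \<Rightarrow>\<^sub>L 'k) \<Rightarrow> ('k \<Rightarrow>\<^sub>L 'k) \<Rightarrow> ('k \<Rightarrow>\<^sub>L 'k)" where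
  "compression p z = p o\<^sub>L z o\<^sub>L p"

text \<open>The vectors \<open>\<theta> r\<^sub>1 x\<^sub>1 \<cdots> \<theta> r\<^sub>n x\<^sub>n u\<close>, with the pairs \<open>(r\<^sub>i, x\<^sub>i)\<close> collected in a list.\<close>

definition dilation_vectors ::
  "('h::complex_hilbert_space \<Rightarrow>\<^sub>L 'h) set \<Rightarrow> ('h \<Rightarrow>\<^sub>L 'k::complex_hilbert_space) \<Rightarrow>
     (real \<Rightarrow> ('k \<Rightarrow>\<^sub>L 'k) \<Rightarrow> ('k \<Rightarrow>\<^sub>L 'k)) \<Rightarrow> 'k set" where
  "dilation_vectors A J \<theta> =
     {foldr (\<lambda>(r, x). blinfun_apply (\<theta> r (extend J x))) rxs (blinfun_apply J u) | rxs u.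
        rxs \<noteq> [] \<and> sorted_wrt (>) (map fst rxs) \<and> (\<forall>(r, x) \<in> set rxs. r \<ge> 0 \<and> x \<in> A)}"

text \<open>The condition \<open>extend J ` A \<subseteq> B\<close> is implicit in applying \<open>\<theta> t\<close>, a map on \<open>B\<close>, to elements of
  \<open>A\<close>.\<close>

definition minimal_dilation ::
  "('h::complex_hilbert_space \<Rightarrow>\<^sub>L 'h) set \<Rightarrow> (real \<Rightarrow> ('h \<Rightarrow>\<^sub>L 'h) \<Rightarrow> ('h \<Rightarrow>\<^sub>L 'h)) \<Rightarrow>
     ('h \<Rightarrow>\<^sub>L 'k::complex_hilbert_space) \<Rightarrow>
     ('k \<Rightarrow>\<^sub>L 'k) set \<Rightarrow> (real \<Rightarrow> ('k \<Rightarrow>\<^sub>L 'k) \<Rightarrow> ('k \<Rightarrow>\<^sub>L 'k)) \<Rightarrow> bool" where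
  "minimal_dilation A \<tau> J B \<theta> \<longleftrightarrow>
     (let p = orth_proj (range (blinfun_apply J)) in
       isometric_embedding J \<and>
       E_semigroup B \<theta> \<and>
       extend J ` A \<subseteq> B \<and>
       compression p ` B = extend J ` A \<and>
       (\<forall>x\<in>A. \<forall>t\<ge>0. extend J (\<tau> t x) = compression p (\<theta> t (extend J x))) \<and>
       closure (cspan (dilation_vectors A J \<theta>)) = UNIV \<and>
       B = von_neumann_algebra hull {\<theta> t (extend J x) | t x. t \<ge> 0 \<and> x \<in> A})"

end

theory Submission
  imports Defs
begin

text \<open>Write \<open>p\<^sub>t = \<theta>\<^sub>t(p)\<close>. Everything rests on the compression formula
  \<open>\<theta>\<^sub>t(p z p) = p\<^sub>t \<theta>\<^sub>t(z) p\<^sub>t\<close> and on the fact that the projections \<open>p\<^sub>t\<close> increase strongly to \<open>1\<close>.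
  They increase because \<open>\<tau>\<close> is unital (\<open>P_ge_p\<close>, \<open>P_mono\<close>), and they tend to \<open>1\<close> because every
  spanning vector of the minimal dilation lies in the range of some \<open>p\<^sub>r\<close> (\<open>P_tendsto\<close>).

  The compression cannot shrink norms on the peripheral space. By simultaneous Diophantine
  approximation, finitely many peripheral elements are almost fixed by \<open>\<theta>\<^sub>t\<close> at arbitrarily large
  times \<open>t\<close> (\<open>peripheral_space_recurrent\<close>). At such times \<open>\<theta>\<^sub>t(p X p) = p\<^sub>t \<theta>\<^sub>t(X) p\<^sub>t\<close> is strongly close to
  \<open>X\<close>, whereas its norm is at most that of \<open>p X p\<close>, as \<open>*\<close>-endomorphisms are completely contractive.
  This applies to matrices entry by entry (\<open>mat_norm_le_compression\<close>).

  The compression sends \<open>E\<^sub>a(\<theta>)\<close> into \<open>E\<^sub>a(\<tau>)\<close> because \<open>p \<le> p\<^sub>t\<close>. Conversely, for \<open>x \<in> E\<^sub>a(\<tau>)\<close> the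
  operators \<open>y\<^sub>t = exp(-iat) \<theta>\<^sub>t(x)\<close> are compatible, \<open>p\<^sub>s y\<^sub>t p\<^sub>s = y\<^sub>s\<close> for \<open>s \<le> t\<close>, so they converge
  strongly to an operator \<open>z\<close> with \<open>p\<^sub>s z p\<^sub>s = y\<^sub>s\<close> for all \<open>s\<close>. An operator is determined by its
  corners \<open>p\<^sub>s z p\<^sub>s\<close>, and comparing corners gives \<open>\<theta>\<^sub>s(z) = exp(ias) z\<close>
  (\<open>lift_peripheral_eigenvector\<close>). So the spans of the eigenspaces correspond, and since the
  compression is isometric the correspondence extends to their norm closures.\<close>

section \<open>The inner product and the Riesz representation theorem\<close>

lemma cinner_add_left:
  "cinner (x + y) z = cinner x z + cinner y (z :: 'a::complex_hilbert_space)"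
  by (metis cinner_commute cinner_add_right complex_cnj_add)

lemma cinner_scaleC_left:
  "cinner (c *\<^sub>C x) y = cnj c * cinner x (y :: 'a::complex_hilbert_space)"
  by (metis cinner_commute cinner_scaleC_right complex_cnj_mult)

lemma cinner_scaleR_right:
  "cinner x (r *\<^sub>R y) = of_real r * cinner x (y :: 'a::complex_hilbert_space)"
  by (metis scaleC_of_real cinner_scaleC_right)

lemma cinner_scaleR_left:
  "cinner (r *\<^sub>R x) y = of_real r * cinner x (y :: 'a::complex_hilbert_space)"
  by (metis scaleC_of_real cinner_scaleC_left complex_cnj_complex_of_real)

lemma cinner_zero [simp]:
  "cinner (x :: 'a::complex_hilbert_space) 0 = 0" "cinner 0 (x :: 'a::complex_hilbert_space) = 0"
  using cinner_scaleR_right[of x 0 x] cinner_scaleR_left[of 0 x x] by auto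

lemma cinner_minus_right: "cinner x (- y) = - cinner x (y :: 'a::complex_hilbert_space)"
  using cinner_scaleR_right[of x "-1" y] by simp

lemma cinner_diff_right:
  "cinner x (y - z) = cinner x y - cinner x (z :: 'a::complex_hilbert_space)"
  using cinner_add_right[of x y "- z"] by (simp add: cinner_minus_right)

lemma cinner_sum_right:
  "cinner x (\<Sum>i\<in>I. f i) = (\<Sum>i\<in>I. cinner x (f i :: 'a::complex_hilbert_space))"
  by (induction I rule: infinite_finite_induct) (auto simp: cinner_add_right)

lemma cinner_sum_left:
  "cinner (\<Sum>i\<in>I. f i) x = (\<Sum>i\<in>I. cinner (f i) (x :: 'a::complex_hilbert_space))"
  by (induction I rule: infinite_finite_induct) (auto simp: cinner_add_left)

lemma norm_add_sq:
  "(norm (x + y))\<^sup>2 = (norm x)\<^sup>2 + 2 * Re (cinner x y) + (norm (y :: 'a::complex_hilbert_space))\<^sup>2"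
proof -
  have "complex_of_real ((norm (x + y))\<^sup>2)
      = of_real ((norm x)\<^sup>2) + (cinner x y + cnj (cinner x y)) + of_real ((norm y)\<^sup>2)"
    unfolding cinner_self[symmetric] cinner_commute[of y x, symmetric]
    by (simp add: cinner_add_left cinner_add_right)
  then show ?thesis
    by (auto simp: complex_add_cnj dest: arg_cong[where f = Re])
qed

lemma norm_diff_sq:
  "(norm (x - y))\<^sup>2 = (norm x)\<^sup>2 - 2 * Re (cinner x y) + (norm (y :: 'a::complex_hilbert_space))\<^sup>2"
  using norm_add_sq[of x "- y"] by (simp add: cinner_minus_right)

text \<open>The triangle inequality belongs to the class, so it can be squared to bound the real part;
  rotating one argument by a unimodular scalar turns the real part into the modulus.\<close>

lemma norm_cinner_le: "cmod (cinner x y) \<le> norm x * norm (y :: 'a::complex_hilbert_space)"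
proof (cases "cinner x y = 0")
  case False
  have re: "Re (cinner x z) \<le> norm x * norm z" for z
  proof -
    have "(norm (x + z))\<^sup>2 \<le> (norm x + norm z)\<^sup>2"
      by (simp add: norm_triangle_ineq power_mono)
    then show ?thesis
      unfolding norm_add_sq by (simp add: power2_sum)
  qed
  define c where "c = cnj (cinner x y) / of_real (cmod (cinner x y))"
  have "cmod c = 1"
    using False by (simp add: c_def norm_divide)
  moreover have "cinner x (c *\<^sub>C y) = of_real (cmod (cinner x y))"
    using False complex_norm_square[of "cinner x y"]
    by (simp add: cinner_scaleC_right c_def field_simps power2_eq_square)
  ultimately show ?thesis
    using re[of "c *\<^sub>C y"] by (simp add: norm_scaleC)
qed simp

lemma cinner_eqI:
  fixes x y :: "'a::complex_hilbert_space"
  assumes "\<And>u. cinner u x = cinner u y"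
  shows "x = y"
proof -
  have "cinner (x - y) (x - y) = 0"
    using assms[of "x - y"] by (simp only: cinner_diff_right) simp
  then show ?thesis
    by (simp add: cinner_self)
qed

text \<open>A representing vector is the minimiser of \<open>w \<mapsto> \<parallel>w\<parallel>\<^sup>2 - 2 Re (f w)\<close>. This functional is bounded
  below, and the parallelogram law makes every minimising sequence Cauchy; at the minimum the
  first variation in every direction vanishes, which says that \<open>Re (f v) = Re \<langle>w, v\<rangle>\<close>.\<close>

theorem riesz_representation:
  fixes f :: "'a::complex_hilbert_space \<Rightarrow> complex"
  assumes add: "\<And>u v. f (u + v) = f u + f v"
    and scale: "\<And>c v. f (c *\<^sub>C v) = c * f v"
    and bound: "\<And>v. cmod (f v) \<le> K * norm v"
  shows "\<exists>w. \<forall>v. f v = cinner w v"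
proof -
  have scaleR: "f (r *\<^sub>R v) = of_real r * f v" for r v
    by (metis scale scaleC_of_real)
  have diff: "f (u - v) = f u - f v" for u v
    using add[of "u - v" v] by simp
  define q where "q w = (norm w)\<^sup>2 - 2 * Re (f w)" for w
  have lower: "- (K\<^sup>2) \<le> q w" for w
  proof -
    have "Re (f w) \<le> K * norm w"
      using bound[of w] complex_Re_le_cmod order_trans by blast
    moreover have "0 \<le> (norm w - K)\<^sup>2" by simp
    ultimately show ?thesis
      unfolding q_def by (simp add: power2_eq_square algebra_simps)
  qed
  define m where "m = Inf (range q)"
  have bdd: "bdd_below (range q)"
    using lower by (rule bdd_belowI2)
  have m_le: "m \<le> q w" for w
    unfolding m_def using bdd by (auto intro: cInf_lower)
  have "\<exists>w. q w < m + 1 / real (Suc n)" for n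
    using cInf_lessD[of "range q" "m + 1 / real (Suc n)"] by (auto simp: m_def)
  then obtain w where w: "\<And>n. q (w n) < m + 1 / real (Suc n)"
    by metis
  \<comment> \<open>parallelogram law, comparing both points with their midpoint\<close>
  have mid: "(norm (u - v))\<^sup>2 \<le> 2 * (q u - m) + 2 * (q v - m)" for u v
  proof -
    have "4 * q ((1/2) *\<^sub>R (u + v)) = (norm (u + v))\<^sup>2 - 4 * Re (f (u + v))"
      by (simp add: q_def scaleR power_mult_distrib power2_eq_square)
    also have "\<dots> = 2 * q u + 2 * q v - (norm (u - v))\<^sup>2"
      by (simp add: q_def norm_add_sq norm_diff_sq add)
    finally show ?thesis
      using m_le[of "(1/2) *\<^sub>R (u + v)"] by simp
  qed
  have "Cauchy w"
  proof (rule metric_CauchyI)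
    fix e :: real
    assume e: "0 < e"
    then obtain N where N: "1 / real (Suc N) < e\<^sup>2 / 4"
      using nat_approx_posE[of "e\<^sup>2 / 4"] by auto
    have close: "q (w k) - m < e\<^sup>2 / 4" if "N \<le> k" for k
    proof -
      have "1 / real (Suc k) \<le> 1 / real (Suc N)"
        using that by (simp add: frac_le)
      then show ?thesis using w[of k] N by linarith
    qed
    show "\<exists>M. \<forall>k\<ge>M. \<forall>l\<ge>M. dist (w k) (w l) < e"
    proof (intro exI allI impI)
      fix k l assume "N \<le> k" "N \<le> l"
      from this[THEN close] have "(norm (w k - w l))\<^sup>2 < e\<^sup>2"
        using mid[of "w k" "w l"] by argo
      then show "dist (w k) (w l) < e"
        using e by (simp add: dist_norm power_less_imp_less_base)
    qed
  qed
  then obtain z where z: "w \<longlonglongrightarrow> z"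
    using Cauchy_convergent_iff convergent_def by blast
  have "(\<lambda>n. f (w n)) \<longlonglongrightarrow> f z"
  proof (rule LIM_zero_cancel, rule Lim_null_comparison)
    show "\<forall>\<^sub>F n in sequentially. norm (f (w n) - f z) \<le> K * norm (w n - z)"
      using bound by (simp flip: diff)
    show "(\<lambda>n. K * norm (w n - z)) \<longlonglongrightarrow> 0"
      using tendsto_mult[OF tendsto_const tendsto_norm[OF LIM_zero[OF z]], of K] by simp
  qed
  then have "(\<lambda>n. q (w n)) \<longlonglongrightarrow> q z"
    unfolding q_def by (intro tendsto_intros z)
  moreover have "(\<lambda>n. m + 1 / real (Suc n)) \<longlonglongrightarrow> m + 0"
    by (intro tendsto_intros LIMSEQ_Suc[OF lim_1_over_n, unfolded o_def])
  ultimately have "q z \<le> m"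
    using w by (intro LIMSEQ_le[of "\<lambda>n. q (w n)" _ "\<lambda>n. m + 1 / real (Suc n)"])
      (auto intro: less_imp_le)
  then have min: "q z \<le> q u" for u
    using m_le[of u] by linarith
  have re: "Re (f v) = Re (cinner z v)" for v
  proof -
    define d where "d = Re (cinner z v) - Re (f v)"
    have var: "0 \<le> 2 * r * d + r\<^sup>2 * (norm v)\<^sup>2" for r
      using min[of "z + r *\<^sub>R v"]
      by (simp add: q_def d_def norm_add_sq add scaleR cinner_scaleR_right power_mult_distrib
          algebra_simps)
    have "d = 0"
    proof (rule ccontr)
      assume d: "d \<noteq> 0"
      define s where "s = 1 + (norm v)\<^sup>2"
      have s: "0 < s" "(norm v)\<^sup>2 = s - 1"
        by (auto simp: s_def add_pos_nonneg)
      \<comment> \<open>the step \<open>- d / s\<close> makes the linear term dominate the quadratic one\<close>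
      have "2 * (- d / s) * d + (- d / s)\<^sup>2 * (s - 1) = - (d\<^sup>2 / s\<^sup>2) * (s + 1)"
        using s(1) by (simp add: power2_eq_square divide_simps) (simp add: algebra_simps)
      also have "\<dots> < 0"
        using d s(1) by (intro mult_neg_pos) auto
      finally show False
        using var[of "- d / s"] unfolding s(2) by linarith
    qed
    then show ?thesis by (simp add: d_def)
  qed
  have "f v = cinner z v" for v
    using re[of v] re[of "\<i> *\<^sub>C v"] by (simp add: complex_eq_iff scale cinner_scaleC_right)
  then show ?thesis by blast
qed


section \<open>Adjoints\<close>

lemma clinear_opsD: "x \<in> clinear_ops \<Longrightarrow> blinfun_apply x (c *\<^sub>C v) = c *\<^sub>C blinfun_apply x v"
  by (simp add: clinear_ops_def)

lemma blinfun_apply_scaleC [simp]: "blinfun_apply (c *\<^sub>C x) v = c *\<^sub>C blinfun_apply x v"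
  by transfer simp

lemma adj_eqI:
  assumes "\<And>u v. cinner (blinfun_apply x u) v = cinner u (blinfun_apply y v)"
  shows "adj x = y"
  unfolding adj_def
proof (rule the_equality)
  fix z
  assume "\<forall>u v. cinner (blinfun_apply x u) v = cinner u (blinfun_apply z v)"
  then have "cinner u (blinfun_apply z v) = cinner u (blinfun_apply y v)" for u v
    using assms by metis
  then show "z = y"
    by (blast intro: blinfun_eqI cinner_eqI)
qed (use assms in simp)

lemma cinner_adj_right:
  assumes x: "x \<in> clinear_ops"
  shows "cinner u (blinfun_apply (adj x) v) = cinner (blinfun_apply x u) v"
proof -
  have "\<exists>w. \<forall>u. cinner v (blinfun_apply x u) = cinner w u" for v
  proof (rule riesz_representation)
    show "cinner v (blinfun_apply x (c *\<^sub>C u)) = c * cinner v (blinfun_apply x u)" for c u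
      by (simp add: clinear_opsD[OF x] cinner_scaleC_right)
    show "cmod (cinner v (blinfun_apply x u)) \<le> (norm v * norm x) * norm u" for u
      by (rule order_trans[OF norm_cinner_le]) (simp add: mult.assoc mult_left_mono norm_blinfun)
  qed (auto simp: blinfun.add_right cinner_add_right)
  then obtain g where g: "\<And>v u. cinner v (blinfun_apply x u) = cinner (g v) u"
    by metis
  have g': "cinner (blinfun_apply x u) v = cinner u (g v)" for u v
    by (metis g cinner_commute)
  have "bounded_linear g"
  proof (rule bounded_linear_intro)
    show "g (v + w) = g v + g w" for v w
      by (rule cinner_eqI) (simp add: cinner_add_right flip: g')
    show "g (r *\<^sub>R v) = r *\<^sub>R g v" for r v
      by (rule cinner_eqI) (simp add: cinner_scaleR_right flip: g')
    show "norm (g v) \<le> norm v * norm x" for v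
    proof (cases "g v = 0")
      case False
      have "(norm (g v))\<^sup>2 = cmod (cinner (g v) (g v))"
        by (simp add: cinner_self del: of_real_power)
      also have "\<dots> = cmod (cinner v (blinfun_apply x (g v)))"
        by (simp add: g)
      also have "\<dots> \<le> norm v * (norm x * norm (g v))"
        by (rule order_trans[OF norm_cinner_le]) (simp add: mult_left_mono norm_blinfun)
      finally show ?thesis
        using False by (simp add: power2_eq_square)
    qed simp
  qed
  then have "\<And>u v. cinner (blinfun_apply x u) v = cinner u (blinfun_apply (Blinfun g) v)"
    by (simp add: bounded_linear_Blinfun_apply g')
  with adj_eqI[of x "Blinfun g"] show ?thesis by metis
qed

lemma cinner_adj_left:
  "x \<in> clinear_ops \<Longrightarrow> cinner (blinfun_apply (adj x) v) u = cinner v (blinfun_apply x u)"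
  by (metis cinner_adj_right cinner_commute)

lemma adj_clinear:
  assumes x: "x \<in> clinear_ops"
  shows "adj x \<in> clinear_ops"
proof -
  have "blinfun_apply (adj x) (c *\<^sub>C v) = c *\<^sub>C blinfun_apply (adj x) v" for c v
    by (rule cinner_eqI) (simp add: cinner_adj_right[OF x] cinner_scaleC_right)
  then show ?thesis
    by (simp add: clinear_ops_def)
qed

text \<open>For a self-adjoint idempotent \<open>q\<close> the vectors \<open>q v\<close> and \<open>v - q v\<close> are orthogonal.\<close>

lemma projection_pythagoras:
  fixes q :: "'a::complex_hilbert_space \<Rightarrow>\<^sub>L 'a"
  assumes q: "q \<in> clinear_ops" "adj q = q" "q o\<^sub>L q = q"
  shows "(norm v)\<^sup>2 = (norm (q v))\<^sup>2 + (norm (v - q v))\<^sup>2"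
proof -
  have "cinner v (q v) = cinner (q v) (q v)"
    by (metis q cinner_adj_right blinfun_apply_blinfun_compose)
  then have "Re (cinner v (q v)) = (norm (q v))\<^sup>2"
    by (simp add: cinner_self)
  then show ?thesis
    by (simp add: norm_diff_sq)
qed

lemma projection_norm_le:
  fixes q :: "'a::complex_hilbert_space \<Rightarrow>\<^sub>L 'a"
  assumes "q \<in> clinear_ops" "adj q = q" "q o\<^sub>L q = q"
  shows "norm (q v) \<le> norm v"
  using projection_pythagoras[OF assms, of v] by (simp add: power2_le_imp_le)


section \<open>Operator matrices\<close>

lemma sum_norm_sq_eq_L2: "(\<Sum>i<n. (norm (\<xi> i))\<^sup>2) = (L2_set (\<lambda>i. norm (\<xi> i)) {..<n})\<^sup>2"
  by (simp add: L2_set_def sum_nonneg)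

text \<open>The crude bound by the sum of the norms of the entries makes the supremum in \<open>mat_norm\<close> finite,
  so that it obeys the usual rules of an operator norm.\<close>

lemma mat_apply_bounded:
  "\<exists>K\<ge>0. \<forall>\<xi>. L2_set (\<lambda>i. norm (mat_apply n X \<xi> i)) {..<n}
      \<le> K * L2_set (\<lambda>i. norm (\<xi> i)) {..<n}"
proof (intro exI conjI allI)
  show "0 \<le> (\<Sum>i<n. \<Sum>j<n. norm (X i j))"
    by (intro sum_nonneg norm_ge_zero)
  fix \<xi>
  have "L2_set (\<lambda>i. norm (mat_apply n X \<xi> i)) {..<n} \<le> (\<Sum>i<n. norm (mat_apply n X \<xi> i))"
    by (rule L2_set_le_sum) simp
  also have "\<dots> \<le> (\<Sum>i<n. \<Sum>j<n. norm (X i j) * L2_set (\<lambda>i. norm (\<xi> i)) {..<n})"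
    unfolding mat_apply_def
  proof (intro sum_mono order_trans[OF norm_sum])
    fix i j assume "j \<in> {..<n}"
    then have "norm (\<xi> j) \<le> L2_set (\<lambda>i. norm (\<xi> i)) {..<n}"
      by (intro member_le_L2_set) auto
    then show "norm (blinfun_apply (X i j) (\<xi> j))
        \<le> norm (X i j) * L2_set (\<lambda>i. norm (\<xi> i)) {..<n}"
      by (meson norm_blinfun order_trans mult_left_mono norm_ge_zero)
  qed
  finally show "L2_set (\<lambda>i. norm (mat_apply n X \<xi> i)) {..<n}
      \<le> (\<Sum>i<n. \<Sum>j<n. norm (X i j)) * L2_set (\<lambda>i. norm (\<xi> i)) {..<n}"
    by (simp add: sum_distrib_right)
qed

lemma bdd_above_mat_norm:
  "bdd_above ((\<lambda>\<xi>. L2_set (\<lambda>i. norm (mat_apply n X \<xi> i)) {..<n}) `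
      {\<xi>. L2_set (\<lambda>i. norm (\<xi> i)) {..<n} \<le> 1})"
proof -
  obtain K where K: "0 \<le> K" "\<And>\<xi>. L2_set (\<lambda>i. norm (mat_apply n X \<xi> i)) {..<n}
      \<le> K * L2_set (\<lambda>i. norm (\<xi> i)) {..<n}"
    using mat_apply_bounded[of n X] by blast
  show ?thesis
  proof (rule bdd_aboveI2)
    fix \<xi> :: "nat \<Rightarrow> 'a"
    assume "\<xi> \<in> {\<xi>. L2_set (\<lambda>i. norm (\<xi> i)) {..<n} \<le> 1}"
    then show "L2_set (\<lambda>i. norm (mat_apply n X \<xi> i)) {..<n} \<le> K"
      using K(1) by (intro order_trans[OF K(2)]) (auto intro: mult_left_le)
  qed
qed

lemma mat_apply_scaleR: "mat_apply n X (\<lambda>i. r *\<^sub>R \<xi> i) i = r *\<^sub>R mat_apply n X \<xi> i"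
  by (simp add: mat_apply_def blinfun.scaleR_right scaleR_sum_right)

lemma norm_mat_apply_le:
  "L2_set (\<lambda>i. norm (mat_apply n X \<xi> i)) {..<n}
    \<le> mat_norm n X * L2_set (\<lambda>i. norm (\<xi> i)) {..<n}"
proof (cases "L2_set (\<lambda>i. norm (\<xi> i)) {..<n} = 0")
  case True
  obtain K where "L2_set (\<lambda>i. norm (mat_apply n X \<xi> i)) {..<n}
      \<le> K * L2_set (\<lambda>i. norm (\<xi> i)) {..<n}"
    using mat_apply_bounded[of n X] by blast
  then show ?thesis by (simp add: True)
next
  case False
  define r where "r = L2_set (\<lambda>i. norm (\<xi> i)) {..<n}"
  have r: "0 < r"
    using False L2_set_nonneg[of "\<lambda>i. norm (\<xi> i)" "{..<n}"] unfolding r_def by linarith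
  have scale: "L2_set (\<lambda>i. norm ((1 / r) *\<^sub>R f i)) {..<n} = L2_set (\<lambda>i. norm (f i)) {..<n} / r"
    for f :: "nat \<Rightarrow> 'a"
    using r by (simp add: L2_set_left_distrib eq_divide_eq)
  have "L2_set (\<lambda>i. norm (mat_apply n X (\<lambda>i. (1 / r) *\<^sub>R \<xi> i) i)) {..<n} \<le> mat_norm n X"
    unfolding mat_norm_def
    by (rule cSUP_upper[OF _ bdd_above_mat_norm]) (use scale[of \<xi>] r in \<open>simp flip: r_def\<close>)
  then have "L2_set (\<lambda>i. norm (mat_apply n X \<xi> i)) {..<n} / r \<le> mat_norm n X"
    by (simp only: mat_apply_scaleR scale)
  then show ?thesis
    using r by (simp add: divide_le_eq flip: r_def)
qed

lemma mat_norm_leI: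
  assumes "0 \<le> c"
    and "\<And>\<xi>. L2_set (\<lambda>i. norm (mat_apply n X \<xi> i)) {..<n}
        \<le> c * L2_set (\<lambda>i. norm (\<xi> i)) {..<n}"
  shows "mat_norm n X \<le> c"
  unfolding mat_norm_def
proof (rule cSUP_least)
  show "{\<xi> :: nat \<Rightarrow> 'a. L2_set (\<lambda>i. norm (\<xi> i)) {..<n} \<le> 1} \<noteq> {}"
    by (auto simp: L2_set_def intro!: exI[of _ "\<lambda>_. 0"])
  fix \<xi> :: "nat \<Rightarrow> 'a"
  assume "\<xi> \<in> {\<xi>. L2_set (\<lambda>i. norm (\<xi> i)) {..<n} \<le> 1}"
  then show "L2_set (\<lambda>i. norm (mat_apply n X \<xi> i)) {..<n} \<le> c"
    using assms(1) by (intro order_trans[OF assms(2)]) (auto intro: mult_left_le)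
qed

lemma mat_norm_nonneg: "0 \<le> mat_norm n X"
proof -
  have "L2_set (\<lambda>i. norm (mat_apply n X (\<lambda>_. 0) i)) {..<n} \<le> mat_norm n X"
    unfolding mat_norm_def
    by (rule cSUP_upper[OF _ bdd_above_mat_norm]) (simp add: L2_set_def)
  then show ?thesis
    by (rule order_trans[OF L2_set_nonneg])
qed

lemma mat_norm_one: "mat_norm 1 (\<lambda>_ _. z) = norm z"
proof (rule antisym)
  have *: "L2_set f {..<Suc 0} = \<bar>f 0\<bar>" for f :: "nat \<Rightarrow> real"
    by (simp add: L2_set_def)
  show "mat_norm 1 (\<lambda>_ _. z) \<le> norm z"
    by (rule mat_norm_leI) (auto simp: * mat_apply_def norm_blinfun)
  show "norm z \<le> mat_norm 1 (\<lambda>_ _. z)"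
  proof (rule norm_blinfun_bound)
    show "norm (blinfun_apply z v) \<le> mat_norm 1 (\<lambda>_ _. z) * norm v" for v
      using norm_mat_apply_le[of 1 "\<lambda>_ _. z" "\<lambda>_. v"] by (simp add: * mat_apply_def)
  qed (rule mat_norm_nonneg)
qed

text \<open>The matrix is \<open>diag(d, \<dots>, d) - Z\<^sup>* Z\<close>; its quadratic form compares \<open>\<parallel>Z \<xi>\<parallel>\<^sup>2\<close> with the form of \<open>d\<close>,
  which is how norm bounds become positivity statements.\<close>

lemma cinner_mat_gram:
  fixes Z :: "nat \<Rightarrow> nat \<Rightarrow> 'a::complex_hilbert_space \<Rightarrow>\<^sub>L 'a"
  assumes Z: "\<And>i j. i < n \<Longrightarrow> j < n \<Longrightarrow> Z i j \<in> clinear_ops"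
  shows "(\<Sum>i<n. cinner (\<xi> i)
      (mat_apply n (\<lambda>i j. (if i = j then d else 0) - (\<Sum>k<n. adj (Z k i) o\<^sub>L Z k j)) \<xi> i))
    = (\<Sum>i<n. cinner (\<xi> i) (blinfun_apply d (\<xi> i)))
      - complex_of_real ((L2_set (\<lambda>k. norm (mat_apply n Z \<xi> k)) {..<n})\<^sup>2)"
proof -
  have diag: "(\<Sum>j<n. blinfun_apply (if i = j then d else 0) (\<xi> j)) = blinfun_apply d (\<xi> i)"
    if "i < n" for i
    using that by (simp add: if_distrib[of blinfun_apply] if_distribR cong: if_cong)
  have "(\<Sum>i<n. cinner (\<xi> i)
        (mat_apply n (\<lambda>i j. (if i = j then d else 0) - (\<Sum>k<n. adj (Z k i) o\<^sub>L Z k j)) \<xi> i))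
      = (\<Sum>i<n. cinner (\<xi> i) (blinfun_apply d (\<xi> i)))
        - (\<Sum>i<n. \<Sum>j<n. \<Sum>k<n. cinner (\<xi> i) (blinfun_apply (adj (Z k i)) (blinfun_apply (Z k j) (\<xi> j))))"
    by (simp add: mat_apply_def blinfun.diff_left blinfun.sum_left sum_subtractf diag
        cinner_diff_right cinner_sum_right)
  also have "(\<Sum>i<n. \<Sum>j<n. \<Sum>k<n. cinner (\<xi> i) (blinfun_apply (adj (Z k i)) (blinfun_apply (Z k j) (\<xi> j))))
      = (\<Sum>i<n. \<Sum>j<n. \<Sum>k<n. cinner (blinfun_apply (Z k i) (\<xi> i)) (blinfun_apply (Z k j) (\<xi> j)))"
    by (intro sum.cong refl) (simp add: cinner_adj_right Z)
  also have "\<dots> = (\<Sum>i<n. \<Sum>k<n. \<Sum>j<n. cinner (blinfun_apply (Z k i) (\<xi> i)) (blinfun_apply (Z k j) (\<xi> j)))"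
    by (intro sum.cong refl sum.swap)
  also have "\<dots> = (\<Sum>k<n. \<Sum>i<n. \<Sum>j<n. cinner (blinfun_apply (Z k i) (\<xi> i)) (blinfun_apply (Z k j) (\<xi> j)))"
    by (rule sum.swap)
  also have "\<dots> = (\<Sum>k<n. cinner (mat_apply n Z \<xi> k) (mat_apply n Z \<xi> k))"
    unfolding mat_apply_def cinner_sum_left unfolding cinner_sum_right by (rule refl)
  also have "\<dots> = complex_of_real ((L2_set (\<lambda>k. norm (mat_apply n Z \<xi> k)) {..<n})\<^sup>2)"
    unfolding sum_norm_sq_eq_L2[symmetric] by (simp add: cinner_self)
  finally show ?thesis .
qed


section \<open>Von Neumann algebras and their endomorphisms\<close>

lemma vn_clinear: "von_neumann_algebra M \<Longrightarrow> x \<in> M \<Longrightarrow> x \<in> clinear_ops"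
  by (auto simp: von_neumann_algebra_def)

lemma vn_scaleC: "von_neumann_algebra M \<Longrightarrow> x \<in> M \<Longrightarrow> c *\<^sub>C x \<in> M"
  by (auto simp: von_neumann_algebra_def)

lemma vn_diff:
  assumes "von_neumann_algebra M" "x \<in> M" "y \<in> M"
  shows "x - y \<in> M"
proof -
  have "x - y = x + (-1) *\<^sub>C y"
    using scaleC_of_real[of "-1" y] by simp
  then show ?thesis
    using assms unfolding von_neumann_algebra_def by metis
qed

lemma vn_zero: "von_neumann_algebra M \<Longrightarrow> 0 \<in> M"
  using vn_diff[of M id_blinfun id_blinfun] by (simp add: von_neumann_algebra_def)

lemma vn_sum: "von_neumann_algebra M \<Longrightarrow> (\<And>i. i \<in> I \<Longrightarrow> f i \<in> M) \<Longrightarrow> (\<Sum>i\<in>I. f i) \<in> M"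
  by (induction I rule: infinite_finite_induct) (auto simp: vn_zero von_neumann_algebra_def)

lemma vn_strong_limit:
  assumes M: "von_neumann_algebra M" "\<And>k :: nat. f k \<in> M"
    and lim: "\<And>v. (\<lambda>k. blinfun_apply (f k) v) \<longlonglongrightarrow> blinfun_apply z v"
  shows "z \<in> M"
proof -
  have "limitin strong_operator_topology f z sequentially"
    unfolding limitin_def
  proof (intro conjI allI impI)
    show "z \<in> topspace strong_operator_topology"
      by (simp add: strong_operator_topology_topspace)
    fix U
    assume U: "openin strong_operator_topology U \<and> z \<in> U"
    then obtain V where V: "openin euclidean V" "U = blinfun_apply -` V"
      unfolding strong_operator_topology_def by (auto simp: openin_pullback_topology)
    have "limitin euclidean (\<lambda>k. blinfun_apply (f k)) (blinfun_apply z) sequentially"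
      unfolding euclidean_product_topology[symmetric] limitin_componentwise
      using lim by simp
    with V U have "\<forall>\<^sub>F k in sequentially. blinfun_apply (f k) \<in> V"
      unfolding limitin_def by blast
    then show "\<forall>\<^sub>F k in sequentially. f k \<in> U"
      by (simp add: V)
  qed
  then show ?thesis
    using M by (intro limitin_closedin[of strong_operator_topology f z sequentially])
      (auto simp: von_neumann_algebra_def)
qed

lemma vn_closed:
  assumes "von_neumann_algebra M"
  shows "closed M"
  unfolding closed_sequential_limits
proof (intro allI impI)
  fix f z
  assume f: "(\<forall>k. f k \<in> M) \<and> f \<longlonglongrightarrow> z"
  then have "(\<lambda>k. blinfun_apply (f k) v) \<longlonglongrightarrow> blinfun_apply z v" for v
    by (intro blinfun.tendsto tendsto_const) simp
  with f show "z \<in> M"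
    using vn_strong_limit[OF assms, of f z] by blast
qed

lemma clinear_on_sum:
  assumes M: "von_neumann_algebra M" and \<Phi>: "clinear_on M \<Phi>" and f: "\<And>i. i \<in> I \<Longrightarrow> f i \<in> M"
  shows "\<Phi> (\<Sum>i\<in>I. f i) = (\<Sum>i\<in>I. \<Phi> (f i))"
  using f
proof (induction I rule: infinite_finite_induct)
  have "\<Phi> (0 *\<^sub>C 0) = 0 *\<^sub>C \<Phi> 0"
    using \<Phi> vn_zero[OF M] unfolding clinear_on_def by blast
  then have 0: "\<Phi> 0 = 0" by simp
  then show "\<Phi> (sum f I) = (\<Sum>i\<in>I. \<Phi> (f i))" if "infinite I" for I
    using that by simp
  show "\<Phi> (sum f {}) = (\<Sum>i\<in>{}. \<Phi> (f i))"
    by (simp add: 0)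
  fix i I
  assume "finite I" "i \<notin> I" "(\<And>i. i \<in> I \<Longrightarrow> f i \<in> M) \<Longrightarrow> \<Phi> (sum f I) = (\<Sum>i\<in>I. \<Phi> (f i))"
    "\<And>j. j \<in> insert i I \<Longrightarrow> f j \<in> M"
  then show "\<Phi> (sum f (insert i I)) = (\<Sum>i\<in>insert i I. \<Phi> (f i))"
    using \<Phi> vn_sum[OF M, of I f] by (simp add: clinear_on_def)
qed

lemma clinear_on_diff:
  assumes M: "von_neumann_algebra M" and \<Phi>: "clinear_on M \<Phi>" and "x \<in> M" "y \<in> M"
  shows "\<Phi> (x - y) = \<Phi> x - \<Phi> y"
proof -
  have "\<Phi> (x - y + y) = \<Phi> (x - y) + \<Phi> y"
    using assms vn_diff[OF M] unfolding clinear_on_def by blast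
  then show ?thesis by simp
qed

text \<open>If \<open>\<parallel>X\<parallel> = c\<close> then \<open>c\<^sup>2 - X\<^sup>* X \<ge> 0\<close>; applying \<open>\<Phi>\<close> entrywise to this positive matrix gives
  \<open>\<Phi>(X)\<^sup>* \<Phi>(X) \<le> c\<^sup>2 \<Phi>(1) \<le> c\<^sup>2\<close>.\<close>

lemma endomorphism_completely_contractive:
  fixes \<Phi> :: "('a::complex_hilbert_space \<Rightarrow>\<^sub>L 'a) \<Rightarrow> ('a \<Rightarrow>\<^sub>L 'a)"
  assumes M: "von_neumann_algebra M" and maps: "\<Phi> ` M \<subseteq> M"
    and cp: "completely_positive_on M \<Phi>"
    and star: "\<And>x. x \<in> M \<Longrightarrow> \<Phi> (adj x) = adj (\<Phi> x)"
    and mult: "\<And>x y. x \<in> M \<Longrightarrow> y \<in> M \<Longrightarrow> \<Phi> (x o\<^sub>L y) = \<Phi> x o\<^sub>L \<Phi> y"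
    and unit: "positive_op (id_blinfun - \<Phi> id_blinfun)"
    and X: "\<And>i j. i < n \<Longrightarrow> j < n \<Longrightarrow> X i j \<in> M"
  shows "mat_norm n (\<lambda>i j. \<Phi> (X i j)) \<le> mat_norm n X"
proof (rule mat_norm_leI[OF mat_norm_nonneg])
  fix \<xi> :: "nat \<Rightarrow> 'a"
  define c where "c = mat_norm n X"
  have c: "0 \<le> c" by (simp add: c_def mat_norm_nonneg)
  define d :: "'a \<Rightarrow>\<^sub>L 'a" where "d = complex_of_real (c\<^sup>2) *\<^sub>C id_blinfun"
  define Y where "Y = (\<lambda>i j. (if i = j then d else 0) - (\<Sum>k<n. adj (X k i) o\<^sub>L X k j))"
  have lin: "clinear_on M \<Phi>"
    using cp by (simp add: completely_positive_on_def)
  have one: "id_blinfun \<in> M" and d: "d \<in> M"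
    using M by (auto simp: von_neumann_algebra_def d_def)
  have gram: "adj (X k i) o\<^sub>L X k j \<in> M" if "i < n" "j < n" "k < n" for i j k
    using M X[OF \<open>k < n\<close>] that by (simp add: von_neumann_algebra_def)
  have Y: "Y i j \<in> M" if "i < n" "j < n" for i j
    unfolding Y_def using that d gram by (intro vn_diff[OF M] vn_sum[OF M]) (auto simp: vn_zero[OF M])
  have "mat_positive n Y"
    unfolding mat_positive_def
  proof
    fix \<eta> :: "nat \<Rightarrow> 'a"
    have "(L2_set (\<lambda>k. norm (mat_apply n X \<eta> k)) {..<n})\<^sup>2
        \<le> (c * L2_set (\<lambda>i. norm (\<eta> i)) {..<n})\<^sup>2"
      unfolding c_def by (intro power_mono norm_mat_apply_le L2_set_nonneg)
    then have "0 \<le> c\<^sup>2 * (\<Sum>i<n. (norm (\<eta> i))\<^sup>2) - (L2_set (\<lambda>k. norm (mat_apply n X \<eta> k)) {..<n})\<^sup>2"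
      by (simp add: sum_norm_sq_eq_L2 power_mult_distrib)
    moreover have "(\<Sum>i<n. cinner (\<eta> i) (mat_apply n Y \<eta> i))
        = complex_of_real (c\<^sup>2 * (\<Sum>i<n. (norm (\<eta> i))\<^sup>2)
            - (L2_set (\<lambda>k. norm (mat_apply n X \<eta> k)) {..<n})\<^sup>2)"
      unfolding Y_def using X vn_clinear[OF M]
      by (subst cinner_mat_gram)
        (auto simp: d_def cinner_scaleC_right cinner_self sum_distrib_left)
    ultimately show "(\<Sum>i<n. cinner (\<eta> i) (mat_apply n Y \<eta> i)) \<in> \<real>\<^sub>\<ge>\<^sub>0"
      by (simp only: nonneg_Reals_of_real_iff)
  qed
  then have "mat_positive n (\<lambda>i j. \<Phi> (Y i j))"
    using cp Y unfolding completely_positive_on_def by blast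
  then have "(\<Sum>i<n. cinner (\<xi> i) (mat_apply n (\<lambda>i j. \<Phi> (Y i j)) \<xi> i)) \<in> \<real>\<^sub>\<ge>\<^sub>0"
    unfolding mat_positive_def by blast
  also have "(\<Sum>i<n. cinner (\<xi> i) (mat_apply n (\<lambda>i j. \<Phi> (Y i j)) \<xi> i))
      = (\<Sum>i<n. cinner (\<xi> i) (mat_apply n (\<lambda>i j. (if i = j then \<Phi> d else 0)
          - (\<Sum>k<n. adj (\<Phi> (X k i)) o\<^sub>L \<Phi> (X k j))) \<xi> i))"
  proof -
    have "\<Phi> (Y i j) = (if i = j then \<Phi> d else 0) - (\<Sum>k<n. adj (\<Phi> (X k i)) o\<^sub>L \<Phi> (X k j))"
      if ij: "i < n" "j < n" for i j
    proof -
      have "\<Phi> (Y i j) = \<Phi> (if i = j then d else 0) - \<Phi> (\<Sum>k<n. adj (X k i) o\<^sub>L X k j)"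
        unfolding Y_def using ij gram d
        by (intro clinear_on_diff[OF M lin] vn_sum[OF M]) (auto simp: vn_zero[OF M])
      also have "\<Phi> (if i = j then d else 0) = (if i = j then \<Phi> d else 0)"
        using clinear_on_sum[OF M lin, of "{}"] by simp
      also have "\<Phi> (\<Sum>k<n. adj (X k i) o\<^sub>L X k j) = (\<Sum>k<n. \<Phi> (adj (X k i) o\<^sub>L X k j))"
        using ij gram by (intro clinear_on_sum[OF M lin]) auto
      also have "\<dots> = (\<Sum>k<n. adj (\<Phi> (X k i)) o\<^sub>L \<Phi> (X k j))"
        using ij X M by (intro sum.cong refl) (auto simp: mult star von_neumann_algebra_def)
      finally show ?thesis .
    qed
    then show ?thesis
      unfolding mat_apply_def by (intro sum.cong arg_cong2[where f = cinner] refl) auto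
  qed
  also have "\<dots> = (\<Sum>i<n. cinner (\<xi> i) (blinfun_apply (\<Phi> d) (\<xi> i)))
      - complex_of_real ((L2_set (\<lambda>k. norm (mat_apply n (\<lambda>i j. \<Phi> (X i j)) \<xi> k)) {..<n})\<^sup>2)"
    using X maps vn_clinear[OF M] by (intro cinner_mat_gram) blast
  finally have "(L2_set (\<lambda>k. norm (mat_apply n (\<lambda>i j. \<Phi> (X i j)) \<xi> k)) {..<n})\<^sup>2
      \<le> (\<Sum>i<n. Re (cinner (\<xi> i) (blinfun_apply (\<Phi> d) (\<xi> i))))"
    by (auto simp: complex_nonneg_Reals_iff)
  also have "\<dots> \<le> (\<Sum>i<n. c\<^sup>2 * (norm (\<xi> i))\<^sup>2)"
  proof (rule sum_mono)
    fix i
    have "0 \<le> Re (cinner (\<xi> i) (blinfun_apply (id_blinfun - \<Phi> id_blinfun) (\<xi> i)))"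
      using unit by (auto simp: positive_op_def complex_nonneg_Reals_iff)
    then have "Re (cinner (\<xi> i) (blinfun_apply (\<Phi> id_blinfun) (\<xi> i))) \<le> (norm (\<xi> i))\<^sup>2"
      by (simp add: blinfun.diff_left cinner_diff_right cinner_self)
    moreover have "\<Phi> d = complex_of_real (c\<^sup>2) *\<^sub>C \<Phi> id_blinfun"
      using lin one by (simp add: clinear_on_def d_def)
    ultimately show "Re (cinner (\<xi> i) (blinfun_apply (\<Phi> d) (\<xi> i))) \<le> c\<^sup>2 * (norm (\<xi> i))\<^sup>2"
      by (simp add: cinner_scaleC_right mult_left_mono del: of_real_power)
  qed
  also have "\<dots> = (c * L2_set (\<lambda>i. norm (\<xi> i)) {..<n})\<^sup>2"
    by (simp add: sum_norm_sq_eq_L2 power_mult_distrib flip: sum_distrib_left)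
  finally show "L2_set (\<lambda>i. norm (mat_apply n (\<lambda>i j. \<Phi> (X i j)) \<xi> i)) {..<n}
      \<le> mat_norm n X * L2_set (\<lambda>i. norm (\<xi> i)) {..<n}"
    unfolding c_def[symmetric] by (rule power2_le_imp_le) (simp add: c)
qed


section \<open>Simultaneous recurrence of characters\<close>

lemma norm_exp_minus_one_near_integer:
  fixes x :: real and k :: int
  shows "cmod (exp (\<i> * complex_of_real (2 * pi * x)) - 1) \<le> 2 * pi * \<bar>x - of_int k\<bar>"
proof -
  have "exp (\<i> * complex_of_real (2 * pi * x))
      = exp (\<i> * complex_of_real (2 * pi * (x - of_int k)) + 2 * of_int k * pi * \<i>)"
    by (simp add: algebra_simps)
  also have "\<dots> = exp (\<i> * complex_of_real (2 * pi * (x - of_int k)))"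
    by (simp add: exp_add exp_eq_1)
  finally have "cmod (exp (\<i> * complex_of_real (2 * pi * x)) - 1)
      = 2 * \<bar>sin (2 * pi * (x - of_int k) / 2)\<bar>"
    by (simp only: dist_exp_i_1)
  also have "\<dots> \<le> 2 * pi * \<bar>x - of_int k\<bar>"
    using abs_sin_x_le_abs_x[of "pi * (x - of_int k)"] by (simp add: abs_mult)
  finally show ?thesis .
qed

text \<open>Dirichlet's theorem is applied to the frequencies multiplied by \<open>M / (2 \<pi>)\<close>: it yields
  \<open>q \<ge> 1\<close> such that all products with \<open>q\<close> are near integers, and \<open>q M \<ge> M\<close> is the required time.\<close>

lemma characters_recurrent:
  fixes S :: "real set"
  assumes "finite S" "0 < e"
  obtains t where "T \<le> t" "0 \<le> t"
    "\<And>a. a \<in> S \<Longrightarrow> cmod (exp (\<i> * complex_of_real a * complex_of_real t) - 1) < e"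
proof -
  obtain f and n :: nat where S: "S = f ` {i. i < n}"
    using finite_imp_nat_seg_image_inj_on[OF assms(1)] by blast
  \<comment> \<open>positivity of \<open>M\<close> is needed even if \<open>T \<le> 0\<close>\<close>
  define M where "M = max T 1"
  have M: "1 \<le> M" "T \<le> M" by (auto simp: M_def)
  obtain N :: nat where N: "0 < N" "2 * pi / e < real N"
    using reals_Archimedean2[of "max 1 (2 * pi / e)"] by (metis less_eq_real_def max_less_iff_conj
        of_nat_0_less_iff order_less_trans zero_less_one)
  obtain q p where q: "0 < q"
    and qp: "\<And>i. i < n \<Longrightarrow> \<bar>of_int q * (f i * M / (2 * pi)) - of_int (p i)\<bar> < 1 / real N"
    using Dirichlet_approx_simult[OF N(1), of n "\<lambda>i. f i * M / (2 * pi)"] by metis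
  show thesis
  proof (rule that[of "of_int q * M"])
    have "1 * M \<le> of_int q * M"
      using q M by (intro mult_right_mono) auto
    then show "T \<le> of_int q * M" "0 \<le> of_int q * M"
      using M by linarith+
    fix a assume "a \<in> S"
    then obtain i where i: "i < n" "a = f i"
      using S by auto
    have "a * (of_int q * M) = 2 * pi * (of_int q * (f i * M / (2 * pi)))"
      by (simp add: i)
    then have "cmod (exp (\<i> * complex_of_real a * complex_of_real (of_int q * M)) - 1)
        \<le> 2 * pi * \<bar>of_int q * (f i * M / (2 * pi)) - of_int (p i)\<bar>"
      using norm_exp_minus_one_near_integer[of "of_int q * (f i * M / (2 * pi))" "p i"]
      by (simp only: mult.assoc of_real_mult[symmetric])
    also have "\<dots> < 2 * pi * (1 / real N)"
      using qp[OF i(1)] by (intro mult_strict_left_mono) auto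
    also have "\<dots> < e"
      using N assms(2) by (simp add: field_simps)
    finally show "cmod (exp (\<i> * complex_of_real a * complex_of_real (of_int q * M)) - 1) < e" .
  qed
qed


section \<open>Peripheral elements of an E-semigroup\<close>

lemma E_semigroup_facts:
  assumes "E_semigroup B \<theta>"
  shows E_vn: "von_neumann_algebra B"
    and E_maps: "0 \<le> t \<Longrightarrow> x \<in> B \<Longrightarrow> \<theta> t x \<in> B"
    and E_clinear: "0 \<le> t \<Longrightarrow> clinear_on B (\<theta> t)"
    and E_semigroup_law: "0 \<le> s \<Longrightarrow> 0 \<le> t \<Longrightarrow> x \<in> B \<Longrightarrow> \<theta> s (\<theta> t x) = \<theta> (s + t) x"
    and E_zero: "x \<in> B \<Longrightarrow> \<theta> 0 x = x"
    and E_adj: "0 \<le> t \<Longrightarrow> x \<in> B \<Longrightarrow> \<theta> t (adj x) = adj (\<theta> t x)"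
    and E_mult: "0 \<le> t \<Longrightarrow> x \<in> B \<Longrightarrow> y \<in> B \<Longrightarrow> \<theta> t (x o\<^sub>L y) = \<theta> t x o\<^sub>L \<theta> t y"
  using assms
  by (simp_all add: E_semigroup_def quantum_dynamical_semigroup_def completely_positive_on_def
      image_subset_iff)

lemma E_mat_norm_le:
  assumes "E_semigroup B \<theta>" "0 \<le> t" and X: "\<And>i j. i < n \<Longrightarrow> j < n \<Longrightarrow> X i j \<in> B"
  shows "mat_norm n (\<lambda>i j. \<theta> t (X i j)) \<le> mat_norm n X"
proof (rule endomorphism_completely_contractive[OF E_vn[OF assms(1)]])
  show "\<theta> t ` B \<subseteq> B" "completely_positive_on B (\<theta> t)" "positive_op (id_blinfun - \<theta> t id_blinfun)"
    using assms(1,2) unfolding E_semigroup_def quantum_dynamical_semigroup_def by blast+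
qed (use assms in \<open>simp_all add: E_adj E_mult\<close>)

lemma E_norm_le:
  assumes "E_semigroup B \<theta>" "0 \<le> t" "x \<in> B"
  shows "norm (\<theta> t x) \<le> norm x"
  using E_mat_norm_le[of B \<theta> t 1 "\<lambda>_ _. x"] assms by (simp only: mat_norm_one)

lemma vn_cspan_subset:
  assumes "von_neumann_algebra M" "S \<subseteq> M"
  shows "cspan S \<subseteq> M"
proof (rule complex_vector.span_minimal[OF assms(2)])
  show "complex_vector.subspace M"
    using assms(1) vn_zero[OF assms(1)]
    by (auto simp: complex_vector.subspace_def von_neumann_algebra_def)
qed

lemma peripheral_space_subset:
  assumes "von_neumann_algebra M"
  shows "peripheral_space M \<sigma> \<subseteq> M"
  unfolding peripheral_space_def
  by (intro closure_minimal vn_closed[OF assms] vn_cspan_subset[OF assms])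
    (auto simp: peripheral_eigenspace_def)

text \<open>An element of the span involves finitely many frequencies, collected in \<open>S\<close>. The constant \<open>C\<close>
  does not depend on \<open>t\<close>, which reduces the recurrence of \<open>z\<close> to that of the characters in \<open>S\<close>.
  Membership in \<open>B\<close> is carried along in the induction because \<open>\<theta> t\<close> is linear only there.\<close>

lemma peripheral_span_near_fixed:
  assumes E: "E_semigroup B \<theta>"
    and z: "z \<in> cspan (\<Union>a. peripheral_eigenspace B \<theta> a)"
  shows "z \<in> B \<and> (\<exists>S C. finite S \<and> 0 \<le> C \<and> (\<forall>t\<ge>0. \<forall>d.
    (\<forall>a\<in>S. cmod (exp (\<i> * complex_of_real a * complex_of_real t) - 1) \<le> d)
      \<longrightarrow> 0 \<le> d \<longrightarrow> norm (\<theta> t z - z) \<le> C * d))"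
  using z
proof (induction rule: complex_vector.span_induct_alt)
  case base
  have "\<theta> t 0 = 0" if "0 \<le> t" for t
    using clinear_on_sum[OF E_vn[OF E] E_clinear[OF E that], of "{}"] by simp
  then show ?case
    using vn_zero[OF E_vn[OF E]] by (intro conjI exI[of _ "{}"] exI[of _ 0]) simp_all
next
  case (step c x y)
  then obtain b where b: "x \<in> peripheral_eigenspace B \<theta> b" by blast
  from step.IH obtain S C where S: "finite S" "0 \<le> C"
    and y: "\<And>t d. 0 \<le> t \<Longrightarrow>
      \<forall>a\<in>S. cmod (exp (\<i> * complex_of_real a * complex_of_real t) - 1) \<le> d \<Longrightarrow>
      0 \<le> d \<Longrightarrow> norm (\<theta> t y - y) \<le> C * d"
    by blast
  have xB: "x \<in> B" and yB: "y \<in> B"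
    using b step.IH by (auto simp: peripheral_eigenspace_def)
  show ?case
  proof (intro exI[of _ "insert b S"] exI[of _ "cmod c * norm x + C"] conjI allI impI)
    show "c *\<^sub>C x + y \<in> B"
      using E_vn[OF E] xB yB by (simp add: von_neumann_algebra_def)
    fix t d :: real
    assume t: "0 \<le> t" and d: "0 \<le> d"
      "\<forall>a\<in>insert b S. cmod (exp (\<i> * complex_of_real a * complex_of_real t) - 1) \<le> d"
    let ?e = "exp (\<i> * complex_of_real b * complex_of_real t)"
    have "\<theta> t (c *\<^sub>C x + y) = c *\<^sub>C \<theta> t x + \<theta> t y"
      using E_clinear[OF E t] xB yB vn_scaleC[OF E_vn[OF E] xB, of c]
      by (simp add: clinear_on_def)
    also have "\<theta> t x = ?e *\<^sub>C x"
      using b t by (simp add: peripheral_eigenspace_def)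
    finally have eq: "\<theta> t (c *\<^sub>C x + y) - (c *\<^sub>C x + y) = (c * (?e - 1)) *\<^sub>C x + (\<theta> t y - y)"
      by (simp add: right_diff_distrib complex_vector.scale_left_diff_distrib
          complex_vector.scale_scale)
    have "norm ((c * (?e - 1)) *\<^sub>C x) \<le> cmod c * norm x * d"
    proof (rule norm_blinfun_bound)
      show "norm (((c * (?e - 1)) *\<^sub>C x) v) \<le> cmod c * norm x * d * norm v" for v
      proof -
        have "norm (((c * (?e - 1)) *\<^sub>C x) v) = cmod c * (cmod (?e - 1) * norm (x v))"
          by (simp add: norm_scaleC norm_mult)
        also have "\<dots> \<le> cmod c * (d * (norm x * norm v))"
          using d by (intro mult_left_mono mult_mono norm_blinfun) auto
        finally show ?thesis by (simp add: mult_ac)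
      qed
    qed (use d in simp)
    then show "norm (\<theta> t (c *\<^sub>C x + y) - (c *\<^sub>C x + y)) \<le> (cmod c * norm x + C) * d"
      unfolding eq using y[OF t _ d(1)] d(2) norm_triangle_ineq[of "(c * (?e - 1)) *\<^sub>C x" "\<theta> t y - y"]
      by (simp add: distrib_right)
  qed (use S in auto)
qed

text \<open>Contractivity of \<open>\<theta>\<^sub>t\<close> lets an approximation within \<open>e / 3\<close> by elements of the span carry
  recurrence over to the norm closure.\<close>

lemma peripheral_space_recurrent:
  assumes E: "E_semigroup B \<theta>" and F: "finite F" "F \<subseteq> peripheral_space B \<theta>" and e: "0 < e"
  obtains t where "T \<le> t" "0 \<le> t" "\<And>z. z \<in> F \<Longrightarrow> norm (\<theta> t z - z) < e"
proof -
  have FB: "F \<subseteq> B"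
    using F(2) peripheral_space_subset[OF E_vn[OF E]] by blast
  have "\<exists>w \<in> cspan (\<Union>a. peripheral_eigenspace B \<theta> a). dist w z < e / 3" if "z \<in> F" for z
  proof -
    have "z \<in> closure (cspan (\<Union>a. peripheral_eigenspace B \<theta> a))"
      using that F(2) by (auto simp: peripheral_space_def)
    then show ?thesis
      using e unfolding closure_approachable by (elim allE[of _ "e / 3"]) auto
  qed
  then obtain w where w: "\<And>z. z \<in> F \<Longrightarrow> w z \<in> cspan (\<Union>a. peripheral_eigenspace B \<theta> a)"
      "\<And>z. z \<in> F \<Longrightarrow> norm (w z - z) < e / 3"
    by (metis dist_norm)
  note near = w(1)[THEN peripheral_span_near_fixed[OF E]]
  have wB: "w z \<in> B" if "z \<in> F" for z
    using near[OF that] by blast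
  from near obtain S C where
    S: "\<And>z. z \<in> F \<Longrightarrow> finite (S z)" and C: "\<And>z. z \<in> F \<Longrightarrow> 0 \<le> C z"
    and SC: "\<And>z t d. z \<in> F \<Longrightarrow> 0 \<le> t \<Longrightarrow>
      \<forall>a\<in>S z. cmod (exp (\<i> * complex_of_real a * complex_of_real t) - 1) \<le> d \<Longrightarrow>
      0 \<le> d \<Longrightarrow> norm (\<theta> t (w z) - w z) \<le> C z * d"
    by metis
  define D where "D = 1 + sum C F"
  have D: "0 < D"
    unfolding D_def using C by (intro add_pos_nonneg sum_nonneg) auto
  have CD: "C z \<le> D" if "z \<in> F" for z
  proof -
    have "C z \<le> sum C F" using C that F(1) by (intro member_le_sum) auto
    then show ?thesis by (simp add: D_def)
  qed
  define d where "d = e / (4 * D)"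
  have d: "0 < d" using e D by (simp add: d_def)
  obtain t where t: "T \<le> t" "0 \<le> t"
    "\<And>a. a \<in> (\<Union>z\<in>F. S z) \<Longrightarrow>
      cmod (exp (\<i> * complex_of_real a * complex_of_real t) - 1) < d"
    using characters_recurrent[of "\<Union>z\<in>F. S z" d T] F(1) S d by blast
  show thesis
  proof (rule that[OF t(1,2)])
    fix z assume z: "z \<in> F"
    have "norm (\<theta> t (w z) - w z) \<le> C z * d"
      using t(3) z d by (intro SC[OF z t(2)]) (auto intro: less_imp_le)
    also have "\<dots> \<le> D * d"
      using CD[OF z] d by (intro mult_right_mono) auto
    also have "\<dots> < e / 3"
      using D e by (simp add: d_def)
    finally have 1: "norm (\<theta> t (w z) - w z) < e / 3" .
    have "\<theta> t (w z - z) = \<theta> t (w z) - \<theta> t z"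
      using z wB FB by (intro clinear_on_diff[OF E_vn[OF E] E_clinear[OF E t(2)]]) auto
    then have 2: "norm (\<theta> t (w z) - \<theta> t z) < e / 3"
      using E_norm_le[OF E t(2), of "w z - z"] w(2)[OF z] vn_diff[OF E_vn[OF E], of "w z" z] z wB FB
      by auto
    have "\<theta> t z - z = (\<theta> t (w z) - w z) - (\<theta> t (w z) - \<theta> t z) + (w z - z)"
      by simp
    then have "norm (\<theta> t z - z)
        \<le> norm (\<theta> t (w z) - w z) + norm (\<theta> t (w z) - \<theta> t z) + norm (w z - z)"
      using norm_triangle_ineq4[of "\<theta> t (w z) - w z" "\<theta> t (w z) - \<theta> t z"]
        norm_triangle_ineq[of "(\<theta> t (w z) - w z) - (\<theta> t (w z) - \<theta> t z)" "w z - z"] by simp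
    then show "norm (\<theta> t z - z) < e"
      using 1 2 w(2)[OF z] by linarith
  qed
qed


section \<open>Isometric embeddings and compressions\<close>

lemma cinner_isometry:
  assumes "isometric_embedding J"
  shows "cinner (J u) (J v) = cinner u v"
proof -
  have J: "J \<in> clinear_ops" and norm: "\<And>u. norm (J u) = norm u"
    using assms by (auto simp: isometric_embedding_def)
  have re: "Re (cinner (J u) (J v)) = Re (cinner u v)" for u v
    using norm_add_sq[of "J u" "J v"] norm_add_sq[of u v]
    by (simp add: norm blinfun.add_right[symmetric])
  show ?thesis
    using re[of u v] re[of u "\<i> *\<^sub>C v"]
    by (simp add: complex_eq_iff clinear_opsD[OF J] cinner_scaleC_right)
qed

lemma adj_isometry_left_inverse:
  assumes "isometric_embedding J"
  shows "adj J (J u) = u"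
proof (rule cinner_eqI)
  fix w
  show "cinner w (adj J (J u)) = cinner w u"
    using assms by (simp add: cinner_adj_right isometric_embedding_def cinner_isometry)
qed

text \<open>This turns the description of \<open>orth_proj\<close> by orthogonality into a formula: \<open>v - J J\<^sup>* v\<close> is
  orthogonal to the range because \<open>J\<^sup>* J = 1\<close>.\<close>

lemma orth_proj_range_isometry:
  assumes J: "isometric_embedding J"
  shows "orth_proj (range (blinfun_apply J)) = J o\<^sub>L adj J"
proof -
  have lin: "J \<in> clinear_ops"
    using J by (simp add: isometric_embedding_def)
  have perp: "cinner (J w) (v - (J o\<^sub>L adj J) v) = 0" for v w
    by (simp add: cinner_diff_right cinner_isometry[OF J] cinner_adj_right[OF lin])
  show ?thesis
    unfolding orth_proj_def
  proof (rule the_equality)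
    show "\<forall>v. (J o\<^sub>L adj J) v \<in> range (blinfun_apply J) \<and>
        (\<forall>w\<in>range (blinfun_apply J). cinner w (v - (J o\<^sub>L adj J) v) = 0)"
      using perp by auto
    fix z
    assume z: "\<forall>v. blinfun_apply z v \<in> range (blinfun_apply J) \<and>
        (\<forall>w\<in>range (blinfun_apply J). cinner w (v - blinfun_apply z v) = 0)"
    show "z = J o\<^sub>L adj J"
    proof (rule blinfun_eqI)
      fix v
      obtain u where u: "z v = J u"
        using z by blast
      have "cinner w u = cinner w (adj J v)" for w
      proof -
        have "cinner (J w) (v - z v) = 0"
          using z by blast
        then show ?thesis
          by (simp add: u cinner_diff_right cinner_isometry[OF J] cinner_adj_right[OF lin])
      qed
      then show "z v = (J o\<^sub>L adj J) v"
        using cinner_eqI[of u "adj J v"] by (simp add: u)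
    qed
  qed
qed

lemma strong_limit_exists:
  fixes f :: "nat \<Rightarrow> 'a::real_normed_vector \<Rightarrow>\<^sub>L 'b::banach"
  assumes cauchy: "\<And>v. Cauchy (\<lambda>n. f n v)" and bound: "\<And>n v. norm (f n v) \<le> K * norm v"
  obtains z :: "'a \<Rightarrow>\<^sub>L 'b" where "\<And>v. (\<lambda>n. f n v) \<longlonglongrightarrow> z v"
proof -
  have "\<forall>v. \<exists>l. (\<lambda>n. f n v) \<longlonglongrightarrow> l"
    using cauchy by (simp add: Cauchy_convergent_iff convergent_def)
  then obtain g where g: "\<And>v. (\<lambda>n. f n v) \<longlonglongrightarrow> g v"
    by metis
  have "bounded_linear g"
  proof (rule bounded_linear_intro)
    show "g (v + w) = g v + g w" for v w
      using LIMSEQ_unique[OF g[of "v + w"]] tendsto_add[OF g[of v] g[of w]]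
      by (simp add: blinfun.add_right)
    show "g (r *\<^sub>R v) = r *\<^sub>R g v" for r v
      using LIMSEQ_unique[OF g[of "r *\<^sub>R v"]] tendsto_scaleR[OF tendsto_const g[of v]]
      by (simp add: blinfun.scaleR_right)
    show "norm (g v) \<le> norm v * K" for v
      using LIMSEQ_le_const2[OF tendsto_norm[OF g[of v]]] bound by (simp add: mult.commute)
  qed
  then show thesis
    using that[of "Blinfun g"] g by (simp add: bounded_linear_Blinfun_apply)
qed

section \<open>The minimal dilation of a quantum Markov semigroup\<close>

locale markov_dilation =
  fixes A :: "('h::complex_hilbert_space \<Rightarrow>\<^sub>L 'h) set"
    and \<tau> :: "real \<Rightarrow> ('h \<Rightarrow>\<^sub>L 'h) \<Rightarrow> ('h \<Rightarrow>\<^sub>L 'h)"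
    and J :: "'h \<Rightarrow>\<^sub>L 'k::complex_hilbert_space"
    and B :: "('k \<Rightarrow>\<^sub>L 'k) set"
    and \<theta> :: "real \<Rightarrow> ('k \<Rightarrow>\<^sub>L 'k) \<Rightarrow> ('k \<Rightarrow>\<^sub>L 'k)"
    and p :: "'k \<Rightarrow>\<^sub>L 'k"
  assumes markov: "quantum_markov_semigroup A \<tau>"
    and dilation: "minimal_dilation A \<tau> J B \<theta>"
    and p_orth_proj: "p = orth_proj (range (blinfun_apply J))"
begin

lemma
  shows isometry: "isometric_embedding J"
    and E: "E_semigroup B \<theta>"
    and extend_in_B: "x \<in> A \<Longrightarrow> extend J x \<in> B"
    and compression_B: "compression p ` B = extend J ` A"
    and dilates: "x \<in> A \<Longrightarrow> 0 \<le> t \<Longrightarrow>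
      extend J (\<tau> t x) = compression p (\<theta> t (extend J x))"
    and dense: "closure (cspan (dilation_vectors A J \<theta>)) = UNIV"
  using dilation unfolding minimal_dilation_def Let_def p_orth_proj[symmetric] by blast+

lemma
  shows A_one: "id_blinfun \<in> A"
    and \<tau>_one: "0 \<le> t \<Longrightarrow> \<tau> t id_blinfun = id_blinfun"
  using markov unfolding quantum_markov_semigroup_def quantum_dynamical_semigroup_def
  by (auto simp: von_neumann_algebra_def)

lemmas B_vn = E_vn[OF E]
  and \<theta>_maps = E_maps[OF E]
  and \<theta>_clinear = E_clinear[OF E]

lemma J_clinear: "J \<in> clinear_ops" and norm_J [simp]: "norm (J u) = norm u"
  using isometry by (auto simp: isometric_embedding_def)

lemma adj_J_J [simp]: "adj J (J u) = u"
  by (rule adj_isometry_left_inverse[OF isometry])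

lemma p_eq: "p = J o\<^sub>L adj J"
  by (simp add: p_orth_proj orth_proj_range_isometry[OF isometry])

lemma p_apply: "p v = J (adj J v)"
  by (simp add: p_eq)

lemma p_extend: "p = extend J id_blinfun"
  by (rule blinfun_eqI) (simp add: p_apply extend_def)

lemma p_in_B: "p \<in> B"
  unfolding p_extend by (rule extend_in_B[OF A_one])

lemma p_clinear: "p \<in> clinear_ops"
  using vn_clinear[OF B_vn p_in_B] .

lemma adj_p: "adj p = p"
proof (rule adj_eqI)
  show "cinner (p u) v = cinner u (p v)" for u v
    using cinner_adj_right[OF J_clinear, of "adj J u" v] cinner_adj_left[OF J_clinear, of u "adj J v"]
    by (simp add: p_apply)
qed

lemma p_idem: "p o\<^sub>L p = p"
  by (rule blinfun_eqI) (simp add: p_apply)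

lemmas p_norm_le = projection_norm_le[OF p_clinear adj_p p_idem]

text \<open>The compression read as an operator on the small space, so that it can be compared with \<open>\<tau>\<close>
  without passing through \<open>extend J\<close>.\<close>

definition pull :: "('k \<Rightarrow>\<^sub>L 'k) \<Rightarrow> ('h \<Rightarrow>\<^sub>L 'h)" where
  "pull z = adj J o\<^sub>L z o\<^sub>L J"

lemma pull_extend [simp]: "pull (extend J x) = x"
  by (rule blinfun_eqI) (simp add: pull_def extend_def)

lemma extend_pull: "extend J (pull z) = compression p z"
  by (rule blinfun_eqI) (simp add: pull_def extend_def compression_def p_apply)

lemma extend_inj: "extend J x = extend J y \<longleftrightarrow> x = y"
  by (metis pull_extend)

lemma extend_scaleC: "extend J (c *\<^sub>C x) = c *\<^sub>C extend J x"
  by (rule blinfun_eqI) (simp add: extend_def clinear_opsD[OF J_clinear])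

lemma compression_scaleC: "compression p (c *\<^sub>C z) = c *\<^sub>C compression p z"
  by (rule blinfun_eqI) (simp add: compression_def clinear_opsD[OF p_clinear])

lemma compression_add: "compression p (z + w) = compression p z + compression p w"
  by (rule blinfun_eqI) (simp add: compression_def blinfun.add_left blinfun.add_right)

lemma compression_in_B:
  assumes "z \<in> B"
  shows "compression p z \<in> B"
proof -
  have "compression p z \<in> extend J ` A"
    using imageI[OF assms, of "compression p"] by (simp only: compression_B)
  then show ?thesis
    by (auto simp: extend_in_B)
qed

lemma norm_compression_le_pull: "norm (compression p z) \<le> norm (pull z)"
proof (rule norm_blinfun_bound)
  fix v
  have "norm (compression p z v) = norm (pull z (adj J v))"
    by (simp add: extend_pull[symmetric] extend_def)
  also have "\<dots> \<le> norm (pull z) * norm (J (adj J v))"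
    by (simp add: norm_blinfun)
  also have "\<dots> \<le> norm (pull z) * norm v"
    using p_norm_le[of v] by (intro mult_left_mono) (simp_all add: p_apply)
  finally show "norm (compression p z v) \<le> norm (pull z) * norm v" .
qed simp

definition P :: "real \<Rightarrow> 'k \<Rightarrow>\<^sub>L 'k" where
  "P t = \<theta> t p"

lemma P_zero: "P 0 = p"
  by (simp add: P_def E_zero[OF E] p_in_B)

lemma P_clinear: "0 \<le> t \<Longrightarrow> P t \<in> clinear_ops"
  unfolding P_def by (intro vn_clinear[OF B_vn] \<theta>_maps p_in_B)

lemma P_adj: "0 \<le> t \<Longrightarrow> adj (P t) = P t"
  unfolding P_def by (metis E_adj[OF E] adj_p p_in_B)

lemma P_idem: "0 \<le> t \<Longrightarrow> P t o\<^sub>L P t = P t"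
  unfolding P_def by (metis E_mult[OF E] p_idem p_in_B)

lemma P_norm_le: "0 \<le> t \<Longrightarrow> norm (P t v) \<le> norm v"
  by (rule projection_norm_le) (simp_all add: P_clinear P_adj P_idem)

text \<open>Unitality gives \<open>p \<theta>\<^sub>t(p) p = \<tau>\<^sub>t(1) = p\<close>: the projection \<open>\<theta>\<^sub>t(p)\<close> preserves the norm of
  every vector of the range of \<open>p\<close>, hence fixes it.\<close>

lemma P_ge_p:
  assumes t: "0 \<le> t"
  shows "P t o\<^sub>L p = p" "p o\<^sub>L P t = p"
proof -
  have fix_J: "P t (J u) = J u" for u
  proof -
    have "compression p (P t) = p"
      using dilates[OF A_one t] by (simp add: P_def \<tau>_one[OF t] flip: p_extend)
    then have "(p o\<^sub>L P t o\<^sub>L p) (J u) = p (J u)"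
      by (simp only: compression_def)
    then have "p (P t (J u)) = J u"
      by (simp add: p_apply)
    then have "norm u \<le> norm (P t (J u))"
      using p_norm_le[of "P t (J u)"] by simp
    then have "(norm u)\<^sup>2 \<le> (norm (P t (J u)))\<^sup>2"
      by (rule power_mono) simp
    then have "(norm (J u - P t (J u)))\<^sup>2 \<le> 0"
      using projection_pythagoras[OF P_clinear[OF t] P_adj[OF t] P_idem[OF t], of "J u"]
      unfolding norm_J by linarith
    then show ?thesis by simp
  qed
  show left: "P t o\<^sub>L p = p"
    by (rule blinfun_eqI) (simp add: p_apply fix_J)
  show "p o\<^sub>L P t = p"
  proof (rule blinfun_eqI, rule cinner_eqI)
    fix v u
    have "cinner u ((p o\<^sub>L P t) v) = cinner ((P t o\<^sub>L p) u) v"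
      using cinner_adj_right[OF p_clinear, of u "P t v"]
        cinner_adj_right[OF P_clinear[OF t], of "p u" v]
      by (simp add: adj_p P_adj[OF t])
    then show "cinner u ((p o\<^sub>L P t) v) = cinner u (p v)"
      using cinner_adj_right[OF p_clinear, of u v] by (simp only: left adj_p)
  qed
qed

text \<open>Apply \<open>\<theta>\<^sub>s\<close> to the relation between \<open>p\<close> and \<open>\<theta>\<^bsub>t-s\<^esub>(p)\<close>.\<close>

lemma P_mono:
  assumes "0 \<le> s" "s \<le> t"
  shows "P t o\<^sub>L P s = P s" "P s o\<^sub>L P t = P s"
proof -
  have t: "P t = \<theta> s (P (t - s))" and B: "P (t - s) \<in> B"
    using assms by (simp_all add: P_def E_semigroup_law[OF E] p_in_B \<theta>_maps)
  show "P t o\<^sub>L P s = P s" "P s o\<^sub>L P t = P s"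
    unfolding t P_def[of s] using P_ge_p[of "t - s"] assms
    by (simp_all add: E_mult[OF E, symmetric] B p_in_B)
qed

text \<open>Multiplicativity of \<open>\<theta>\<^sub>t\<close> turns compression by \<open>p\<close> into compression by \<open>\<theta>\<^sub>t(p)\<close>.\<close>

lemma \<theta>_compression:
  assumes "0 \<le> t" "z \<in> B"
  shows "\<theta> t (compression p z) = P t o\<^sub>L \<theta> t z o\<^sub>L P t"
proof -
  have "p o\<^sub>L z \<in> B"
    using B_vn p_in_B assms(2) by (simp add: von_neumann_algebra_def)
  then show ?thesis
    by (simp add: compression_def P_def E_mult[OF E] assms p_in_B)
qed

lemma P_sandwich_mono:
  assumes "0 \<le> s" "s \<le> t"
  shows "P s o\<^sub>L (P t o\<^sub>L z o\<^sub>L P t) o\<^sub>L P s = P s o\<^sub>L z o\<^sub>L P s"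
proof (rule blinfun_eqI)
  fix v
  have "P s (P t w) = P s w" "P t (P s w) = P s w" for w
    using P_mono[OF assms] by (metis blinfun_apply_blinfun_compose)+
  then show "(P s o\<^sub>L (P t o\<^sub>L z o\<^sub>L P t) o\<^sub>L P s) v = (P s o\<^sub>L z o\<^sub>L P s) v"
    by simp
qed

text \<open>A dilation vector \<open>\<theta>\<^sub>r(x) \<cdots> u\<close> with leading time \<open>r\<close> lies in the range of \<open>\<theta>\<^sub>r(p)\<close>, because
  \<open>x = p x\<close>. So minimality makes the union of the ranges dense.\<close>

lemma span_dilation_vectors_fixed:
  assumes "v \<in> cspan (dilation_vectors A J \<theta>)"
  shows "\<exists>T\<ge>0. \<forall>t\<ge>T. P t v = v"
  using assms
proof (induction rule: complex_vector.span_induct_alt)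
  case base
  show ?case by auto
next
  case (step c v w)
  from step.hyps obtain rxs u where
    v: "v = foldr (\<lambda>(r, x). blinfun_apply (\<theta> r (extend J x))) rxs (blinfun_apply J u)"
    and ne: "rxs \<noteq> []" and ok: "\<forall>(r, x) \<in> set rxs. r \<ge> 0 \<and> x \<in> A"
    unfolding dilation_vectors_def by blast
  from ne obtain r x rest where rxs: "rxs = (r, x) # rest"
    by (metis list.exhaust surj_pair)
  define v' where "v' = foldr (\<lambda>(r, x). blinfun_apply (\<theta> r (extend J x))) rest (blinfun_apply J u)"
  have v': "v = \<theta> r (extend J x) v'" and r: "0 \<le> r" and x: "x \<in> A"
    using v ok by (auto simp: rxs v'_def)
  have "p o\<^sub>L extend J x = extend J x"
    by (rule blinfun_eqI) (simp add: extend_def p_apply)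
  then have "P r o\<^sub>L \<theta> r (extend J x) = \<theta> r (extend J x)"
    unfolding P_def by (metis E_mult[OF E r p_in_B extend_in_B[OF x]])
  then have "P r v = v"
    unfolding v' by (metis blinfun_apply_blinfun_compose)
  then have v_fix: "P t v = v" if "r \<le> t" for t
    using P_mono(1)[OF r that] by (metis blinfun_apply_blinfun_compose)
  from step.IH obtain T where T: "0 \<le> T" "\<And>t. T \<le> t \<Longrightarrow> P t w = w"
    by blast
  show ?case
  proof (intro exI[of _ "max r T"] conjI allI impI)
    fix t assume "max r T \<le> t"
    then show "P t (c *\<^sub>C v + w) = c *\<^sub>C v + w"
      using v_fix[of t] T(2)[of t] r clinear_opsD[OF P_clinear[of t]] by (simp add: blinfun.add_right)
  qed (use r in simp)
qed

lemma P_tendsto: "((\<lambda>t. P t v) \<longlongrightarrow> v) at_top"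
proof (rule tendstoI)
  fix e :: real
  assume "0 < e"
  moreover have "v \<in> closure (cspan (dilation_vectors A J \<theta>))"
    by (simp add: dense)
  ultimately obtain w where w: "w \<in> cspan (dilation_vectors A J \<theta>)" "dist w v < e / 2"
    unfolding closure_approachable by (meson half_gt_zero)
  obtain T where T: "0 \<le> T" "\<And>t. T \<le> t \<Longrightarrow> P t w = w"
    using span_dilation_vectors_fixed[OF w(1)] by blast
  have "dist (P t v) v < e" if "T \<le> t" for t
  proof -
    have "P t v - v = P t (v - w) + (w - v)"
      using T(2)[OF that] by (simp add: blinfun.diff_right)
    then have "norm (P t v - v) \<le> norm (P t (v - w)) + norm (w - v)"
      by (metis norm_triangle_ineq)
    also have "\<dots> \<le> norm (v - w) + norm (w - v)"
      using T(1) that by (intro add_right_mono P_norm_le) simp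
    also have "\<dots> < e"
      using w(2) by (simp add: dist_norm norm_minus_commute)
    finally show ?thesis by (simp add: dist_norm)
  qed
  then show "\<forall>\<^sub>F t in at_top. dist (P t v) v < e"
    using eventually_at_top_linorder by blast
qed

lemma P_sandwich_tendsto:
  assumes t: "filterlim t at_top sequentially" "\<And>k. 0 \<le> t k"
    and w: "w \<longlonglongrightarrow> z"
  shows "(\<lambda>k. (P (t k) o\<^sub>L w k o\<^sub>L P (t k)) v) \<longlonglongrightarrow> z v"
proof -
  have lim: "(\<lambda>k. P (t k) u) \<longlonglongrightarrow> u" for u
    using filterlim_compose[OF P_tendsto t(1)] by (simp add: o_def)
  have b: "(\<lambda>k. w k (P (t k) v)) \<longlonglongrightarrow> z v"
    by (intro blinfun.tendsto w lim)
  have "(\<lambda>k. P (t k) (w k (P (t k) v) - z v)) \<longlonglongrightarrow> 0"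
  proof (rule Lim_null_comparison)
    show "\<forall>\<^sub>F k in sequentially. norm (P (t k) (w k (P (t k) v) - z v)) \<le> norm (w k (P (t k) v) - z v)"
      by (intro always_eventually allI P_norm_le t(2))
    show "(\<lambda>k. norm (w k (P (t k) v) - z v)) \<longlonglongrightarrow> 0"
      using tendsto_norm_zero[OF LIM_zero[OF b]] .
  qed
  from tendsto_add[OF this lim[of "z v"]] show ?thesis
    by (simp add: blinfun.diff_right)
qed

text \<open>Since \<open>\<theta>\<^sub>t(p)\<close> tends strongly to \<open>1\<close>, an operator is the strong limit of its corners.\<close>

lemma eq_of_P_sandwich_eq:
  assumes "0 \<le> s" and eq: "\<And>t. s \<le> t \<Longrightarrow> P t o\<^sub>L z o\<^sub>L P t = P t o\<^sub>L w o\<^sub>L P t"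
  shows "z = w"
proof (rule blinfun_eqI)
  fix v
  define t where "t k = s + real k" for k
  have t: "filterlim t at_top sequentially"
    unfolding t_def by (rule filterlim_tendsto_add_at_top[OF tendsto_const filterlim_real_sequentially])
  have t0: "0 \<le> t k" and ts: "s \<le> t k" for k
    using assms(1) by (auto simp: t_def)
  show "z v = w v"
    using P_sandwich_tendsto[OF t t0 tendsto_const[of z], of v]
      P_sandwich_tendsto[OF t t0 tendsto_const[of w], of v]
    unfolding eq[OF ts] by (rule LIMSEQ_unique)
qed

section \<open>The compression is completely isometric on the peripheral space\<close>

lemma compression_completely_positive: "completely_positive_on S (compression p)"
  unfolding completely_positive_on_def
proof (intro conjI allI impI)
  show "clinear_on S (compression p)"
    by (simp add: clinear_on_def compression_add compression_scaleC)
  fix n and X :: "nat \<Rightarrow> nat \<Rightarrow> 'k \<Rightarrow>\<^sub>L 'k"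
  assume X: "mat_positive n X"
  show "mat_positive n (\<lambda>i j. compression p (X i j))"
    unfolding mat_positive_def
  proof
    fix \<xi> :: "nat \<Rightarrow> 'k"
    have "cinner (\<xi> i) (mat_apply n (\<lambda>i j. compression p (X i j)) \<xi> i)
        = cinner (p (\<xi> i)) (mat_apply n X (\<lambda>i. p (\<xi> i)) i)" for i
      using cinner_adj_right[OF p_clinear]
      by (simp add: mat_apply_def compression_def adj_p cinner_sum_right)
    then show "(\<Sum>i<n. cinner (\<xi> i) (mat_apply n (\<lambda>i j. compression p (X i j)) \<xi> i)) \<in> \<real>\<^sub>\<ge>\<^sub>0"
      using X by (simp add: mat_positive_def)
  qed
qed

lemma mat_norm_compression_le: "mat_norm n (\<lambda>i j. compression p (X i j)) \<le> mat_norm n X"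
proof (rule mat_norm_leI[OF mat_norm_nonneg])
  fix \<xi> :: "nat \<Rightarrow> 'k"
  have "mat_apply n (\<lambda>i j. compression p (X i j)) \<xi> i = p (mat_apply n X (\<lambda>i. p (\<xi> i)) i)" for i
    by (simp add: mat_apply_def compression_def blinfun.sum_right)
  then have "L2_set (\<lambda>i. norm (mat_apply n (\<lambda>i j. compression p (X i j)) \<xi> i)) {..<n}
      \<le> L2_set (\<lambda>i. norm (mat_apply n X (\<lambda>i. p (\<xi> i)) i)) {..<n}"
    by (intro L2_set_mono) (simp_all add: p_norm_le)
  also have "\<dots> \<le> mat_norm n X * L2_set (\<lambda>i. norm (p (\<xi> i))) {..<n}"
    by (rule norm_mat_apply_le)
  also have "\<dots> \<le> mat_norm n X * L2_set (\<lambda>i. norm (\<xi> i)) {..<n}"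
    by (intro mult_left_mono mat_norm_nonneg L2_set_mono p_norm_le) simp
  finally show "L2_set (\<lambda>i. norm (mat_apply n (\<lambda>i j. compression p (X i j)) \<xi> i)) {..<n}
      \<le> mat_norm n X * L2_set (\<lambda>i. norm (\<xi> i)) {..<n}" .
qed

text \<open>Along times \<open>t\<^sub>k \<rightarrow> \<infinity>\<close> at which the entries of \<open>X\<close> recur, \<open>\<theta>\<close> applied to the compressed
  matrix tends strongly back to \<open>X\<close>, while complete contractivity of \<open>\<theta>\<close> keeps its norm below
  that of the compressed matrix.\<close>

lemma mat_norm_le_compression:
  assumes X: "\<And>i j. i < n \<Longrightarrow> j < n \<Longrightarrow> X i j \<in> peripheral_space B \<theta>"
  shows "mat_norm n X \<le> mat_norm n (\<lambda>i j. compression p (X i j))"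
proof (rule mat_norm_leI[OF mat_norm_nonneg])
  fix \<xi> :: "nat \<Rightarrow> 'k"
  let ?F = "(\<lambda>(i, j). X i j) ` ({..<n} \<times> {..<n})"
  have XB: "X i j \<in> B" if "i < n" "j < n" for i j
    using X[OF that] peripheral_space_subset[OF B_vn] by blast
  have F: "finite ?F" "?F \<subseteq> peripheral_space B \<theta>"
    using X by auto
  have "\<exists>t. real k \<le> t \<and> 0 \<le> t \<and> (\<forall>z\<in>?F. norm (\<theta> t z - z) < 1 / real (Suc k))" for k
  proof -
    have "0 < 1 / real (Suc k)" by simp
    from peripheral_space_recurrent[OF E F this, of "real k"] show ?thesis by metis
  qed
  then obtain t where t: "\<And>k. real k \<le> t k" "\<And>k. 0 \<le> t k"
    and near: "\<And>k z. z \<in> ?F \<Longrightarrow> norm (\<theta> (t k) z - z) < 1 / real (Suc k)"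
    by metis
  have t_top: "filterlim t at_top sequentially"
    by (rule filterlim_at_top_mono[OF filterlim_real_sequentially]) (simp add: t)
  have conv: "(\<lambda>k. \<theta> (t k) (X i j)) \<longlonglongrightarrow> X i j" if "i < n" "j < n" for i j
  proof (rule LIM_zero_cancel, rule Lim_null_comparison)
    show "\<forall>\<^sub>F k in sequentially. norm (\<theta> (t k) (X i j) - X i j) \<le> 1 / real (Suc k)"
      using near[of "X i j"] that by (intro always_eventually allI less_imp_le) auto
    show "(\<lambda>k. 1 / real (Suc k)) \<longlonglongrightarrow> 0"
      by (rule LIMSEQ_Suc[OF lim_1_over_n])
  qed
  have "(\<lambda>k. \<theta> (t k) (compression p (X i j)) (\<xi> j)) \<longlonglongrightarrow> X i j (\<xi> j)" if "i < n" "j < n" for i j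
    using P_sandwich_tendsto[OF t_top t(2) conv[OF that]] by (simp only: \<theta>_compression[OF t(2) XB[OF that]])
  then have "(\<lambda>k. L2_set (\<lambda>i. norm (mat_apply n (\<lambda>i j. \<theta> (t k) (compression p (X i j))) \<xi> i)) {..<n})
      \<longlonglongrightarrow> L2_set (\<lambda>i. norm (mat_apply n X \<xi> i)) {..<n}"
    unfolding L2_set_def mat_apply_def
    by (intro tendsto_real_sqrt tendsto_sum tendsto_power tendsto_norm) auto
  moreover have "L2_set (\<lambda>i. norm (mat_apply n (\<lambda>i j. \<theta> (t k) (compression p (X i j))) \<xi> i)) {..<n}
      \<le> mat_norm n (\<lambda>i j. compression p (X i j)) * L2_set (\<lambda>i. norm (\<xi> i)) {..<n}" for k
    by (intro order_trans[OF norm_mat_apply_le] mult_right_mono E_mat_norm_le[OF E t(2)]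
        compression_in_B XB L2_set_nonneg)
  ultimately show "L2_set (\<lambda>i. norm (mat_apply n X \<xi> i)) {..<n}
      \<le> mat_norm n (\<lambda>i j. compression p (X i j)) * L2_set (\<lambda>i. norm (\<xi> i)) {..<n}"
    by (intro LIMSEQ_le_const2) auto
qed

lemma compression_completely_isometric:
  "completely_isometric_on (peripheral_space B \<theta>) (compression p)"
  unfolding completely_isometric_on_def
proof (intro conjI allI impI)
  show "clinear_on (peripheral_space B \<theta>) (compression p)"
    by (simp add: clinear_on_def compression_add compression_scaleC)
qed (auto intro!: antisym mat_norm_compression_le mat_norm_le_compression)

lemma norm_le_compression:
  assumes "z \<in> peripheral_space B \<theta>"
  shows "norm z \<le> norm (compression p z)"
  using mat_norm_le_compression[of 1 "\<lambda>_ _. z"] assms by (simp only: mat_norm_one)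

section \<open>Lifting peripheral eigenvectors to the dilation\<close>

lemma character_add:
  "exp (\<i> * complex_of_real a * complex_of_real s) * exp (\<i> * complex_of_real a * complex_of_real t)
    = exp (\<i> * complex_of_real a * complex_of_real (s + t))"
  by (simp add: exp_add[symmetric] algebra_simps)

text \<open>As \<open>p \<le> \<theta>\<^sub>t(p)\<close>, compressing \<open>\<theta>\<^sub>t(p z p) = \<theta>\<^sub>t(p) \<theta>\<^sub>t(z) \<theta>\<^sub>t(p)\<close> to the range of \<open>p\<close> gives the same
  as compressing \<open>\<theta>\<^sub>t(z)\<close>.\<close>

lemma pull_peripheral_eigenspace:
  assumes "z \<in> peripheral_eigenspace B \<theta> a"
  shows "pull z \<in> peripheral_eigenspace A \<tau> a"
proof -
  have z: "z \<in> B" and eig: "\<And>t. 0 \<le> t \<Longrightarrow>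
      \<theta> t z = exp (\<i> * complex_of_real a * complex_of_real t) *\<^sub>C z"
    using assms by (auto simp: peripheral_eigenspace_def)
  have A: "pull z \<in> A"
  proof -
    obtain x where "x \<in> A" "compression p z = extend J x"
      using z compression_B by blast
    then show ?thesis by (metis extend_pull extend_inj)
  qed
  have "\<tau> t (pull z) = exp (\<i> * complex_of_real a * complex_of_real t) *\<^sub>C pull z" if t: "0 \<le> t" for t
  proof -
    have "extend J (\<tau> t (pull z)) = compression p (P t o\<^sub>L \<theta> t z o\<^sub>L P t)"
      by (simp add: dilates[OF A t] extend_pull \<theta>_compression[OF t z])
    also have "\<dots> = compression p (\<theta> t z)"
      using P_sandwich_mono[OF order_refl t] by (simp add: compression_def P_zero)
    also have "\<dots> = extend J (exp (\<i> * complex_of_real a * complex_of_real t) *\<^sub>C pull z)"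
      by (simp add: eig[OF t] compression_scaleC extend_scaleC extend_pull)
    finally show ?thesis
      by (simp only: extend_inj)
  qed
  with A show ?thesis by (simp add: peripheral_eigenspace_def)
qed

text \<open>The lift is the strong limit of \<open>y\<^sub>t = exp(-iat) \<theta>\<^sub>t(x)\<close>. For \<open>v\<close> in the range of \<open>\<theta>\<^sub>s(p)\<close> the vectors
  \<open>y\<^sub>t v\<close>, \<open>t \<ge> s\<close>, are successive orthogonal projections of one another, so their norms increase and
  their differences are controlled by the Pythagorean identity; this yields convergence. The
  eigenvalue equation for the limit is then checked on corners.\<close>

lemma lift_peripheral_eigenvector:
  assumes "x \<in> peripheral_eigenspace A \<tau> a"
  obtains z where "z \<in> peripheral_eigenspace B \<theta> a" "pull z = x"
proof -
  have x: "x \<in> A" and eig: "\<And>t. 0 \<le> t \<Longrightarrow>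
      \<tau> t x = exp (\<i> * complex_of_real a * complex_of_real t) *\<^sub>C x"
    using assms by (auto simp: peripheral_eigenspace_def)
  define X where "X = extend J x"
  have XB: "X \<in> B" using x by (simp add: X_def extend_in_B)
  define y where "y t = exp (\<i> * complex_of_real a * complex_of_real (- t)) *\<^sub>C \<theta> t X" for t
  have yB: "y t \<in> B" if "0 \<le> t" for t
    unfolding y_def using that by (intro vn_scaleC[OF B_vn] \<theta>_maps XB)
  have y_bound: "norm (y t v) \<le> norm X * norm v" if "0 \<le> t" for t v
  proof -
    have "norm (y t v) = norm (\<theta> t X v)"
      by (simp add: y_def norm_scaleC)
    also have "\<dots> \<le> norm (\<theta> t X) * norm v"
      by (rule norm_blinfun)
    also have "\<dots> \<le> norm X * norm v"
      using E_norm_le[OF E that XB] by (rule mult_right_mono) simp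
    finally show ?thesis .
  qed
  have compat: "P s o\<^sub>L y t o\<^sub>L P s = y s" if st: "0 \<le> s" "s \<le> t" for s t
  proof -
    have c: "compression p (\<theta> (t - s) X) = exp (\<i> * complex_of_real a * complex_of_real (t - s)) *\<^sub>C X"
      unfolding X_def using st by (simp add: dilates[OF x, symmetric] eig extend_scaleC)
    have "P s o\<^sub>L \<theta> t X o\<^sub>L P s = P s o\<^sub>L \<theta> s (\<theta> (t - s) X) o\<^sub>L P s"
      using st by (simp add: E_semigroup_law[OF E] XB)
    also have "\<dots> = \<theta> s (compression p (\<theta> (t - s) X))"
      using st by (simp add: \<theta>_compression \<theta>_maps XB)
    also have "\<dots> = exp (\<i> * complex_of_real a * complex_of_real (t - s)) *\<^sub>C \<theta> s X"
      unfolding c using \<theta>_clinear[OF st(1)] XB by (simp add: clinear_on_def)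
    finally have "P s o\<^sub>L \<theta> t X o\<^sub>L P s
        = exp (\<i> * complex_of_real a * complex_of_real (t - s)) *\<^sub>C \<theta> s X" .
    moreover have "P s o\<^sub>L y t o\<^sub>L P s
        = exp (\<i> * complex_of_real a * complex_of_real (- t)) *\<^sub>C (P s o\<^sub>L \<theta> t X o\<^sub>L P s)"
      by (rule blinfun_eqI) (simp add: y_def clinear_opsD[OF P_clinear[OF st(1)]])
    ultimately show ?thesis
      using character_add[of a "- t" "t - s"] by (simp add: y_def complex_vector.scale_scale)
  qed
  have cauchy_P: "Cauchy (\<lambda>n. y (real n) (P (real m) v))" for m v
  proof -
    define w where "w = P (real m) v"
    have w: "P t w = w" if "real m \<le> t" for t
      unfolding w_def using P_mono(1)[of "real m" t] that
      by (metis blinfun_apply_blinfun_compose of_nat_0_le_iff)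
    have incr: "(norm (y t w - y s w))\<^sup>2 = (norm (y t w))\<^sup>2 - (norm (y s w))\<^sup>2"
      if "real m \<le> s" "s \<le> t" for s t
    proof -
      have s: "0 \<le> s" using that by linarith
      have "y s w = P s (y t w)"
        using compat[OF s that(2)] w[OF that(1)] by (metis blinfun_apply_blinfun_compose)
      then show ?thesis
        using projection_pythagoras[OF P_clinear[OF s] P_adj[OF s] P_idem[OF s], of "y t w"] by simp
    qed
    define f where "f n = (norm (y (real (n + m)) w))\<^sup>2" for n
    have "incseq f"
    proof (rule incseq_SucI)
      show "f n \<le> f (Suc n)" for n
        using incr[of "real (n + m)" "real (Suc n + m)"]
          zero_le_power2[of "norm (y (real (Suc n + m)) w - y (real (n + m)) w)"]
        unfolding f_def by linarith
    qed
    moreover have "f n \<le> (norm X * norm w)\<^sup>2" for n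
      unfolding f_def by (intro power_mono y_bound) auto
    ultimately have "Cauchy f"
      by (metis incseq_convergent LIMSEQ_imp_Cauchy)
    have "Cauchy (\<lambda>n. y (real (n + m)) w)"
    proof (rule CauchyI')
      fix e :: real assume e: "0 < e"
      then obtain N where N: "\<And>k l. N \<le> k \<Longrightarrow> N \<le> l \<Longrightarrow> norm (f k - f l) < e\<^sup>2"
        using CauchyD[OF \<open>Cauchy f\<close>, of "e\<^sup>2"] by auto
      show "\<exists>M. \<forall>k\<ge>M. \<forall>l>k. dist (y (real (k + m)) w) (y (real (l + m)) w) < e"
      proof (intro exI allI impI)
        fix k l assume kl: "N \<le> k" "k < l"
        have "(norm (y (real (l + m)) w - y (real (k + m)) w))\<^sup>2 = f l - f k"
          unfolding f_def using kl by (intro incr) auto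
        also have "\<dots> < e\<^sup>2"
          using N[of l k] kl by (simp add: abs_less_iff)
        finally have "norm (y (real (l + m)) w - y (real (k + m)) w) < e"
          using e by (simp add: power_less_imp_less_base)
        then show "dist (y (real (k + m)) w) (y (real (l + m)) w) < e"
          by (simp add: dist_norm norm_minus_commute)
      qed
    qed
    then show ?thesis
      unfolding Cauchy_convergent_iff w_def
      using convergent_ignore_initial_segment[of "\<lambda>n. y (real n) w" m] by (simp add: w_def)
  qed
  have cauchy: "Cauchy (\<lambda>n. y (real n) v)" for v
  proof (rule CauchyI)
    fix e :: real assume e: "0 < e"
    define L where "L = norm X + 1"
    have L: "0 < L" by (simp add: L_def add_nonneg_pos)
    define d where "d = e / (3 * L)"
    have d: "0 < d" using e L by (simp add: d_def)
    have "(\<lambda>m. P (real m) v) \<longlonglongrightarrow> v"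
      using filterlim_compose[OF P_tendsto filterlim_real_sequentially] by (simp add: o_def)
    then obtain m where m: "norm (P (real m) v - v) < d"
      using LIMSEQ_D[OF _ d] by blast
    obtain N where N: "\<And>k l. N \<le> k \<Longrightarrow> N \<le> l \<Longrightarrow>
        norm (y (real k) (P (real m) v) - y (real l) (P (real m) v)) < e / 3"
      using CauchyD[OF cauchy_P[of m v], of "e / 3"] e by auto
    have small: "norm (y (real k) (P (real m) v - v)) < e / 3" for k
    proof -
      have "norm (y (real k) (P (real m) v - v)) \<le> norm X * norm (P (real m) v - v)"
        by (rule y_bound) simp
      also have "\<dots> \<le> norm X * d"
        using m by (intro mult_left_mono) auto
      also have "\<dots> < L * d"
        using d by (simp add: L_def)
      also have "\<dots> = e / 3"
        using L by (simp add: d_def)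
      finally show ?thesis .
    qed
    show "\<exists>M. \<forall>k\<ge>M. \<forall>l\<ge>M. norm (y (real k) v - y (real l) v) < e"
    proof (intro exI allI impI)
      fix k l assume kl: "N \<le> k" "N \<le> l"
      have eq: "y (real k) v - y (real l) v
          = (y (real k) (P (real m) v) - y (real l) (P (real m) v))
            - y (real k) (P (real m) v - v) + y (real l) (P (real m) v - v)"
        by (simp add: blinfun.diff_right)
      show "norm (y (real k) v - y (real l) v) < e"
        unfolding eq
        using small[of k] small[of l] N[OF kl]
          norm_triangle_ineq4[of "y (real k) (P (real m) v) - y (real l) (P (real m) v)"
            "y (real k) (P (real m) v - v)"]
          norm_triangle_ineq[of "(y (real k) (P (real m) v) - y (real l) (P (real m) v))
            - y (real k) (P (real m) v - v)" "y (real l) (P (real m) v - v)"]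
        by linarith
    qed
  qed
  obtain z :: "'k \<Rightarrow>\<^sub>L 'k" where z: "\<And>v. (\<lambda>n. y (real n) v) \<longlonglongrightarrow> z v"
    using strong_limit_exists[OF cauchy y_bound] by auto
  have zB: "z \<in> B"
    by (rule vn_strong_limit[OF B_vn _ z]) (simp add: yB)
  have Pz: "P s o\<^sub>L z o\<^sub>L P s = y s" if s: "0 \<le> s" for s
  proof (rule blinfun_eqI)
    fix v
    have "(\<lambda>n. P s (y (real n) (P s v))) \<longlonglongrightarrow> P s (z (P s v))"
      by (intro blinfun.tendsto tendsto_const z)
    moreover have "\<forall>\<^sub>F n in sequentially. P s (y (real n) (P s v)) = y s v"
    proof -
      have "\<forall>\<^sub>F n in sequentially. s \<le> real n"
        using filterlim_real_sequentially by (simp add: filterlim_at_top)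
      then show ?thesis
        by eventually_elim (metis compat[OF s] blinfun_apply_blinfun_compose)
    qed
    ultimately have "(\<lambda>n. y s v) \<longlonglongrightarrow> P s (z (P s v))"
      by (rule Lim_transform_eventually)
    then show "(P s o\<^sub>L z o\<^sub>L P s) v = y s v"
      by (simp add: LIMSEQ_const_iff)
  qed
  have "\<theta> s z = exp (\<i> * complex_of_real a * complex_of_real s) *\<^sub>C z" if s: "0 \<le> s" for s
  proof (rule eq_of_P_sandwich_eq[OF s])
    fix t assume t: "s \<le> t"
    then have ts: "0 \<le> t - s" and t0: "0 \<le> t" using s by auto
    let ?e = "exp (\<i> * complex_of_real a * complex_of_real s)"
    have Pt: "P t = \<theta> s (P (t - s))" and B: "P (t - s) \<in> B"
      using s ts by (simp_all add: P_def E_semigroup_law[OF E] p_in_B \<theta>_maps)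
    have "P t o\<^sub>L \<theta> s z o\<^sub>L P t = \<theta> s (P (t - s) o\<^sub>L z o\<^sub>L P (t - s))"
      using B_vn B zB by (simp add: Pt E_mult[OF E s] von_neumann_algebra_def)
    also have "\<dots> = \<theta> s (y (t - s))"
      by (simp add: Pz[OF ts])
    also have "\<dots> = exp (\<i> * complex_of_real a * complex_of_real (- (t - s))) *\<^sub>C \<theta> s (\<theta> (t - s) X)"
      unfolding y_def using \<theta>_clinear[OF s] \<theta>_maps[OF ts XB] by (simp add: clinear_on_def)
    also have "\<theta> s (\<theta> (t - s) X) = \<theta> t X"
      using s ts by (simp add: E_semigroup_law[OF E] XB)
    also have "exp (\<i> * complex_of_real a * complex_of_real (- (t - s))) *\<^sub>C \<theta> t X = ?e *\<^sub>C y t"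
      using character_add[of a s "- t"] by (simp add: y_def complex_vector.scale_scale)
    also have "\<dots> = P t o\<^sub>L ?e *\<^sub>C z o\<^sub>L P t"
      unfolding Pz[OF t0, symmetric]
      by (rule blinfun_eqI) (simp add: clinear_opsD[OF P_clinear[OF t0]])
    finally show "P t o\<^sub>L \<theta> s z o\<^sub>L P t = P t o\<^sub>L ?e *\<^sub>C z o\<^sub>L P t" .
  qed
  then have "z \<in> peripheral_eigenspace B \<theta> a"
    using zB by (simp add: peripheral_eigenspace_def)
  moreover have "pull z = x"
  proof -
    have "extend J (pull z) = y 0"
      using Pz[of 0] by (simp add: extend_pull compression_def P_zero)
    also have "\<dots> = extend J x"
      by (simp add: y_def E_zero[OF E XB]) (simp add: X_def)
    finally show ?thesis by (simp add: extend_inj)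
  qed
  ultimately show thesis by (rule that)
qed

section \<open>Surjectivity\<close>

lemma subspace_closure:
  fixes S :: "'a::real_normed_vector set"
  assumes S: "subspace S"
  shows "subspace (closure S)"
proof (rule subspaceI)
  show "0 \<in> closure S"
    using subspace_0[OF S] closure_subset by blast
next
  fix x y assume "x \<in> closure S" "y \<in> closure S"
  then obtain f g where f: "\<And>n. f n \<in> S" "f \<longlonglongrightarrow> x" and g: "\<And>n. g n \<in> S" "g \<longlonglongrightarrow> y"
    unfolding closure_sequential by blast
  have "(\<lambda>n. f n + g n) \<longlonglongrightarrow> x + y"
    using f(2) g(2) by (rule tendsto_add)
  moreover have "f n + g n \<in> S" for n
    using S f(1) g(1) by (rule subspace_add)
  ultimately show "x + y \<in> closure S"
    unfolding closure_sequential by (intro exI[of _ "\<lambda>n. f n + g n"]) simp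
next
  fix c :: real and x assume "x \<in> closure S"
  then obtain f where f: "\<And>n. f n \<in> S" "f \<longlonglongrightarrow> x"
    unfolding closure_sequential by blast
  have "(\<lambda>n. c *\<^sub>R f n) \<longlonglongrightarrow> c *\<^sub>R x"
    by (intro tendsto_intros f(2))
  moreover have "c *\<^sub>R f n \<in> S" for n
    using S f(1) by (rule subspace_scale)
  ultimately show "c *\<^sub>R x \<in> closure S"
    unfolding closure_sequential by (intro exI[of _ "\<lambda>n. c *\<^sub>R f n"]) simp
qed

lemma subspace_peripheral_space: "subspace (peripheral_space M \<sigma>)"
  unfolding peripheral_space_def
proof (rule subspace_closure)
  let ?S = "\<Union>a. peripheral_eigenspace M \<sigma> a"
  show "subspace (cspan ?S)"
    unfolding subspace_def
    by (auto simp: complex_vector.span_zero complex_vector.span_add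
        complex_vector.span_scale simp flip: scaleC_of_real)
qed

lemma bounded_linear_pull: "bounded_linear pull"
  unfolding pull_def[abs_def]
  using bounded_linear_compose
    [OF bounded_bilinear.bounded_linear_left[OF bounded_bilinear_blinfun_compose]
      bounded_bilinear.bounded_linear_right[OF bounded_bilinear_blinfun_compose]] .

text \<open>The spans of the eigenspaces correspond by the two preceding results. Since \<open>pull\<close> is bounded below
  on the complete space \<open>\<P>(\<theta>)\<close>, the image of that space is closed and therefore contains the closure
  of the span below.\<close>

lemma pull_peripheral_space: "pull ` peripheral_space B \<theta> = peripheral_space A \<tau>"
proof -
  let ?EB = "cspan (\<Union>a. peripheral_eigenspace B \<theta> a)"
  let ?EA = "cspan (\<Union>a. peripheral_eigenspace A \<tau> a)"
  have "module_hom scaleC scaleC pull"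
    unfolding module_hom_iff
  proof (intro conjI allI complex_vector.module_axioms)
    show "pull (z + w) = pull z + pull w" for z w
      by (rule blinfun_eqI) (simp add: pull_def blinfun.add_left blinfun.add_right)
    show "pull (c *\<^sub>C z) = c *\<^sub>C pull z" for c z
      by (rule blinfun_eqI) (simp add: pull_def clinear_opsD[OF adj_clinear[OF J_clinear]])
  qed
  then have "pull ` ?EB = cspan (pull ` (\<Union>a. peripheral_eigenspace B \<theta> a))"
    by (simp add: module_hom.span_image cspan_def)
  also have "pull ` (\<Union>a. peripheral_eigenspace B \<theta> a) = (\<Union>a. peripheral_eigenspace A \<tau> a)"
  proof (intro equalityI subsetI)
    fix x assume "x \<in> (\<Union>a. peripheral_eigenspace A \<tau> a)"
    then obtain a where "x \<in> peripheral_eigenspace A \<tau> a" by blast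
    then obtain z where "z \<in> peripheral_eigenspace B \<theta> a" "pull z = x"
      by (rule lift_peripheral_eigenvector)
    then show "x \<in> pull ` (\<Union>a. peripheral_eigenspace B \<theta> a)" by blast
  qed (auto intro: pull_peripheral_eigenspace)
  finally have span: "pull ` ?EB = ?EA" .
  have "norm z \<le> norm (pull z)" if "z \<in> peripheral_space B \<theta>" for z
    using norm_le_compression[OF that] norm_compression_le_pull[of z] by linarith
  moreover have "complete (peripheral_space B \<theta>)"
    by (simp add: complete_eq_closed peripheral_space_def)
  ultimately have "complete (pull ` peripheral_space B \<theta>)"
    using complete_isometric_image[of 1, OF _ subspace_peripheral_space bounded_linear_pull]
    by auto
  then have "closed (pull ` peripheral_space B \<theta>)"
    by (simp add: complete_eq_closed)
  moreover have "?EA \<subseteq> pull ` peripheral_space B \<theta>"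
    unfolding span[symmetric] peripheral_space_def by (intro image_mono closure_subset)
  ultimately have "peripheral_space A \<tau> \<subseteq> pull ` peripheral_space B \<theta>"
    unfolding peripheral_space_def[of A] by (intro closure_minimal)
  moreover have "pull ` peripheral_space B \<theta> \<subseteq> peripheral_space A \<tau>"
    unfolding peripheral_space_def span[symmetric]
    by (rule closure_bounded_linear_image_subset[OF bounded_linear_pull])
  ultimately show ?thesis by blast
qed

lemma compression_bij_betw:
  "bij_betw (compression p) (peripheral_space B \<theta>) (extend J ` peripheral_space A \<tau>)"
proof (rule bij_betw_imageI)
  show "inj_on (compression p) (peripheral_space B \<theta>)"
  proof (rule inj_onI)
    fix z w
    assume zw: "z \<in> peripheral_space B \<theta>" "w \<in> peripheral_space B \<theta>"
      and eq: "compression p z = compression p w"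
    have "compression p (z - w) = 0"
      using compression_add[of "z - w" w] eq by simp
    then have "norm (z - w) \<le> 0"
      using norm_le_compression[OF subspace_diff[OF subspace_peripheral_space zw]] by simp
    then show "z = w" by simp
  qed
  show "compression p ` peripheral_space B \<theta> = extend J ` peripheral_space A \<tau>"
    by (simp add: extend_pull image_image flip: pull_peripheral_space)
qed

end

theorem theorem4p6:
  fixes A :: "('h::complex_hilbert_space \<Rightarrow>\<^sub>L 'h) set"
    and \<tau> :: "real \<Rightarrow> ('h \<Rightarrow>\<^sub>L 'h) \<Rightarrow> ('h \<Rightarrow>\<^sub>L 'h)"
    and J :: "'h \<Rightarrow>\<^sub>L 'k::complex_hilbert_space"
    and B :: "('k \<Rightarrow>\<^sub>L 'k) set"
    and \<theta> :: "real \<Rightarrow> ('k \<Rightarrow>\<^sub>L 'k) \<Rightarrow> ('k \<Rightarrow>\<^sub>L 'k)"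
    and p :: "'k \<Rightarrow>\<^sub>L 'k"
  assumes "quantum_markov_semigroup A \<tau>"
    and "minimal_dilation A \<tau> J B \<theta>"
    and "p = orth_proj (range (blinfun_apply J))"
  shows "completely_positive_on (peripheral_space B \<theta>) (compression p) \<and>
    completely_isometric_on (peripheral_space B \<theta>) (compression p) \<and>
    bij_betw (compression p) (peripheral_space B \<theta>) (extend J ` peripheral_space A \<tau>)"
proof -
  interpret markov_dilation A \<tau> J B \<theta> p
    using assms by unfold_locales
  show ?thesis
    using compression_completely_positive compression_completely_isometric compression_bij_betw
    by blast
qed

end
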